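(* For every sequence $r_k\downarrow0$ with $0<r_k<1$, there are a Hilbert space $\mathcal H$, von Neumann algebras $M,N\subset B(\mathcal H)$, a positive self-adjoint operator $G$ on $\mathcal H$ with compact resolvent, finite spectral multiplicities, $\inf\sigma(G)=0$, and first positive eigenvalue equal to $1$, together with energies $E_k\to\infty$, such that $$\Gamma(M,N)=4,\qquad 4-\Gamma_{G,E_k}(M,N)\ge r_k\quad(k\ge3).$$ Consequently there is no function $R:[0,\infty)\to[0,\infty)$ with $R(E)\to0$ as $E\to\infty$, independent of $G,M,N$, for which $$\Gamma(M,N)-\Gamma_{G,E}(M,N)\le R(E)$$ holds for all such triples $(G,M,N)$ and all sufficiently large $E$.
   Context: For von Neumann algebras $M,N\subset B(\mathcal H)$, with $D_a(x):=-i[a,x]$ and $\|\cdot\|_{\mathrm{cb}}$ the completely bounded norm, $\Gamma(M,N):=\sup\|[D_a,D_b]\|_{\mathrm{cb}}$ over self-adjoint $a\in M$, $b\in N$ with $\|a\|,\|b\|\le1$. For a positive self-adjoint $G$ on $\mathcal H$, $E>\inf\sigma(G)$ and bounded self-adjoint $h$, $$\gamma_{G,E}(h):=2\sup_\rho\sqrt{\operatorname{Tr}(\rho h^2)-\operatorname{Tr}(\rho h)^2},$$ the supremum over density operators $\rho$ on $\mathcal H$ with $\operatorname{Tr}(G\rho)\le E$; and $\Gamma_{G,E}(M,N):=\sup\gamma_{G,E}(-i[a,b])$ over self-adjoint $a\in M$, $b\in N$ with $\|a\|,\|b\|\le1$. "Such triples" means positive self-adjoint $G$ with compact resolvent, finite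 spectral multiplicities, $\inf\sigma(G)=0$ and first positive eigenvalue $1$, and von Neumann algebras $M,N$ on the same Hilbert space. *)

theory Defs
  imports "HOL-Analysis.Analysis"
begin

section \<open>Complex Hilbert spaces\<close>

text \<open>
  The inner product is conjugate-linear in the first and linear in the second argument. The class
  extends the library's \<^class>\<open>real_inner\<close>, whose inner product is the real part of the complex one;
  in particular norm, topology and \<^const>\<open>onorm\<close> are those of the library.
\<close>

class complex_hilbert_space = real_inner + complete_space +
  fixes scaleC :: "complex \<Rightarrow> 'a \<Rightarrow> 'a" (infixr "*\<^sub>C" 75)
    and cinner :: "'a \<Rightarrow> 'a \<Rightarrow> complex"
  assumes scaleC_add_right: "c *\<^sub>C (x + y) = c *\<^sub>C x + c *\<^sub>C y"
    and scaleC_add_left: "(c + d) *\<^sub>C x = c *\<^sub>C x + d *\<^sub>C x"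
    and scaleC_scaleC: "c *\<^sub>C d *\<^sub>C x = (c * d) *\<^sub>C x"
    and scaleC_of_real: "complex_of_real r *\<^sub>C x = r *\<^sub>R x"
    and cinner_commute: "cinner x y = cnj (cinner y x)"
    and cinner_add_right: "cinner x (y + z) = cinner x y + cinner x z"
    and cinner_scaleC_right: "cinner x (c *\<^sub>C y) = c * cinner x y"
    and Re_cinner: "Re (cinner x y) = inner x y"

global_interpretation complex_vector: vector_space
  "scaleC :: complex \<Rightarrow> 'a \<Rightarrow> 'a :: complex_hilbert_space"
proof
  show "1 *\<^sub>C x = x" for x :: 'a
    using scaleC_of_real[of 1 x] by simp
qed (simp_all add: scaleC_add_right scaleC_add_left scaleC_scaleC)


section \<open>Bounded operators and von Neumann algebras\<close>

definition bounded_op :: "('h \<Rightarrow> 'h :: complex_hilbert_space) \<Rightarrow> bool" where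
  "bounded_op T \<longleftrightarrow> bounded_linear T \<and> (\<forall>c x. T (c *\<^sub>C x) = c *\<^sub>C T x)"

definition is_adjoint :: "('h \<Rightarrow> 'h :: complex_hilbert_space) \<Rightarrow> ('h \<Rightarrow> 'h) \<Rightarrow> bool" where
  "is_adjoint T S \<longleftrightarrow> (\<forall>x y. cinner (T x) y = cinner x (S y))"

definition bounded_selfadjoint :: "('h \<Rightarrow> 'h :: complex_hilbert_space) \<Rightarrow> bool" where
  "bounded_selfadjoint T \<longleftrightarrow> bounded_op T \<and> is_adjoint T T"

definition commutant ::
  "('h \<Rightarrow> 'h :: complex_hilbert_space) set \<Rightarrow> ('h \<Rightarrow> 'h) set" where
  "commutant S = {T. bounded_op T \<and> (\<forall>A\<in>S. T \<circ> A = A \<circ> T)}"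

text \<open>A self-adjoint set of bounded operators that equals its bicommutant is automatically a unital
  \<open>*\<close>-algebra.\<close>

definition von_neumann_algebra :: "('h \<Rightarrow> 'h :: complex_hilbert_space) set \<Rightarrow> bool" where
  "von_neumann_algebra M \<longleftrightarrow>
     M \<subseteq> Collect bounded_op \<and> (\<forall>A\<in>M. \<exists>B\<in>M. is_adjoint A B) \<and> commutant (commutant M) = M"

definition sa_unit_ball :: "('h \<Rightarrow> 'h :: complex_hilbert_space) set \<Rightarrow> ('h \<Rightarrow> 'h) set" where
  "sa_unit_ball M = {a \<in> M. bounded_selfadjoint a \<and> onorm a \<le> 1}"

definition commutator ::
  "('h \<Rightarrow> 'h :: complex_hilbert_space) \<Rightarrow> ('h \<Rightarrow> 'h) \<Rightarrow> 'h \<Rightarrow> 'h" where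
  "commutator a b = (\<lambda>v. a (b v) - b (a v))"


section \<open>The completely bounded norm\<close>

text \<open>
  An \<open>n \<times> n\<close> matrix of bounded operators is a function of two indices, of which only the values at
  indices below \<open>n\<close> matter. Its norm is the operator norm on the \<open>n\<close>-fold direct sum of the Hilbert
  space. Both norms are extended reals, as a linear map need not be completely bounded.
\<close>

definition op_matrix_norm ::
  "nat \<Rightarrow> (nat \<Rightarrow> nat \<Rightarrow> 'h \<Rightarrow> 'h :: complex_hilbert_space) \<Rightarrow> ereal" where
  "op_matrix_norm n X =
     (SUP v \<in> {v :: nat \<Rightarrow> 'h. sqrt (\<Sum>j<n. (norm (v j))\<^sup>2) \<le> 1}.
        ereal (sqrt (\<Sum>i<n. (norm (\<Sum>j<n. X i j (v j)))\<^sup>2)))"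

definition cb_norm :: "(('h \<Rightarrow> 'h :: complex_hilbert_space) \<Rightarrow> 'h \<Rightarrow> 'h) \<Rightarrow> ereal" where
  "cb_norm \<Phi> =
     (SUP (n, X) \<in> {(n, X). 1 \<le> n \<and> (\<forall>i<n. \<forall>j<n. bounded_op (X i j)) \<and> op_matrix_norm n X \<le> 1}.
        op_matrix_norm n (\<lambda>i j. \<Phi> (X i j)))"

definition inner_derivation ::
  "('h \<Rightarrow> 'h :: complex_hilbert_space) \<Rightarrow> ('h \<Rightarrow> 'h) \<Rightarrow> 'h \<Rightarrow> 'h" where
  "inner_derivation a x = (\<lambda>v. (- \<i>) *\<^sub>C commutator a x v)"

definition derivation_commutator ::
  "('h \<Rightarrow> 'h :: complex_hilbert_space) \<Rightarrow> ('h \<Rightarrow> 'h) \<Rightarrow> ('h \<Rightarrow> 'h) \<Rightarrow> 'h \<Rightarrow> 'h" where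
  "derivation_commutator a b x =
     (\<lambda>v. inner_derivation a (inner_derivation b x) v - inner_derivation b (inner_derivation a x) v)"

definition Gamma_MN ::
  "('h \<Rightarrow> 'h :: complex_hilbert_space) set \<Rightarrow> ('h \<Rightarrow> 'h) set \<Rightarrow> ereal" where
  "Gamma_MN M N = (SUP (a, b) \<in> sa_unit_ball M \<times> sa_unit_ball N. cb_norm (derivation_commutator a b))"


section \<open>Unbounded operators\<close>

text \<open>An unbounded operator is a partial function; its domain is \<^term>\<open>dom G\<close>.\<close>

type_synonym 'h unbounded_op = "'h \<rightharpoonup> 'h"

definition densely_defined_linear :: "'h :: complex_hilbert_space unbounded_op \<Rightarrow> bool" where
  "densely_defined_linear G \<longleftrightarrow>
     complex_vector.subspace (dom G) \<and> closure (dom G) = UNIV \<and>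
     (\<forall>x\<in>dom G. \<forall>y\<in>dom G. \<forall>c. the (G (c *\<^sub>C x + y)) = c *\<^sub>C the (G x) + the (G y))"

text \<open>The second conjunct says that the graphs of the adjoint of \<open>G\<close> and of \<open>G\<close> coincide, domains
  included.\<close>

definition unbounded_selfadjoint :: "'h :: complex_hilbert_space unbounded_op \<Rightarrow> bool" where
  "unbounded_selfadjoint G \<longleftrightarrow>
     densely_defined_linear G \<and>
     (\<forall>y z. (\<forall>x\<in>dom G. cinner (the (G x)) y = cinner x z) \<longleftrightarrow> G y = Some z)"

definition positive_selfadjoint :: "'h :: complex_hilbert_space unbounded_op \<Rightarrow> bool" where
  "positive_selfadjoint G \<longleftrightarrow>
     unbounded_selfadjoint G \<and> (\<forall>x\<in>dom G. 0 \<le> Re (cinner x (the (G x))))"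

definition is_resolvent ::
  "'h :: complex_hilbert_space unbounded_op \<Rightarrow> complex \<Rightarrow> ('h \<Rightarrow> 'h) \<Rightarrow> bool" where
  "is_resolvent G z R \<longleftrightarrow>
     bounded_op R \<and> (\<forall>y. R y \<in> dom G \<and> the (G (R y)) - z *\<^sub>C R y = y) \<and>
     (\<forall>x\<in>dom G. R (the (G x) - z *\<^sub>C x) = x)"

definition op_spectrum :: "'h :: complex_hilbert_space unbounded_op \<Rightarrow> complex set" where
  "op_spectrum G = {z. \<nexists>R. is_resolvent G z R}"

definition compact_op :: "('h \<Rightarrow> 'h :: complex_hilbert_space) \<Rightarrow> bool" where
  "compact_op T \<longleftrightarrow> bounded_op T \<and> compact (closure (T ` cball 0 1))"

text \<open>By the resolvent identity it does not matter whether one or every resolvent is required to be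
  compact.\<close>

definition compact_resolvent :: "'h :: complex_hilbert_space unbounded_op \<Rightarrow> bool" where
  "compact_resolvent G \<longleftrightarrow> (\<exists>z R. is_resolvent G z R \<and> compact_op R)"

definition eigenspace :: "'h :: complex_hilbert_space unbounded_op \<Rightarrow> real \<Rightarrow> 'h set" where
  "eigenspace G \<mu> = {x. G x = Some (complex_of_real \<mu> *\<^sub>C x)}"

definition is_eigenvalue :: "'h :: complex_hilbert_space unbounded_op \<Rightarrow> real \<Rightarrow> bool" where
  "is_eigenvalue G \<mu> \<longleftrightarrow> (\<exists>x\<in>eigenspace G \<mu>. x \<noteq> 0)"

definition finite_multiplicities :: "'h :: complex_hilbert_space unbounded_op \<Rightarrow> bool" where
  "finite_multiplicities G \<longleftrightarrow>
     (\<forall>\<mu>. \<exists>F. finite F \<and> eigenspace G \<mu> \<subseteq> complex_vector.span F)"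

text \<open>Real parts lose nothing below, since the spectrum of a self-adjoint operator is real.\<close>

definition admissible_triple ::
  "'h :: complex_hilbert_space unbounded_op \<Rightarrow> ('h \<Rightarrow> 'h) set \<Rightarrow> ('h \<Rightarrow> 'h) set \<Rightarrow> bool" where
  "admissible_triple G M N \<longleftrightarrow>
     positive_selfadjoint G \<and> compact_resolvent G \<and> finite_multiplicities G \<and>
     (INF z\<in>op_spectrum G. ereal (Re z)) = 0 \<and>
     is_eigenvalue G 1 \<and> (\<forall>\<mu>. 0 < \<mu> \<and> \<mu> < 1 \<longrightarrow> \<not> is_eigenvalue G \<mu>) \<and>
     von_neumann_algebra M \<and> von_neumann_algebra N"


section \<open>Traces, density operators and energy\<close>

definition orthonormal_basis :: "'h :: complex_hilbert_space set \<Rightarrow> bool" where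
  "orthonormal_basis B \<longleftrightarrow>
     (\<forall>e\<in>B. \<forall>f\<in>B. cinner e f = (if e = f then 1 else 0)) \<and>
     closure (complex_vector.span B) = UNIV"

text \<open>
  A bounded operator is trace class iff its diagonal is summable in every orthonormal basis; the sum is
  then the same in all of them. The following relation thus says that \<open>T\<close> is trace class with
  trace \<open>t\<close>.
\<close>

definition has_trace :: "('h \<Rightarrow> 'h :: complex_hilbert_space) \<Rightarrow> complex \<Rightarrow> bool" where
  "has_trace T t \<longleftrightarrow>
     bounded_op T \<and> (\<forall>B. orthonormal_basis B \<longrightarrow> ((\<lambda>e. cinner e (T e)) has_sum t) B)"

definition density_operator :: "('h \<Rightarrow> 'h :: complex_hilbert_space) \<Rightarrow> bool" where
  "density_operator \<rho> \<longleftrightarrow>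
     bounded_selfadjoint \<rho> \<and> (\<forall>x. 0 \<le> Re (cinner x (\<rho> x))) \<and> has_trace \<rho> 1"

text \<open>
  For positive self-adjoint \<open>G\<close>, the bounded operators \<open>t G (G + t)\<^sup>-\<^sup>1\<close> increase to \<open>G\<close> as
  \<open>t \<rightarrow> \<infinity>\<close>. As \<open>G\<close> is unbounded, \<open>Tr (G \<rho>) \<in> [0, \<infinity>]\<close> is the limit of
  \<open>Tr (\<rho> t G (G + t)\<^sup>-\<^sup>1)\<close>; if \<open>\<rho>\<close> has eigenvalues \<open>p\<^sub>i\<close> and eigenvectors \<open>\<psi>\<^sub>i\<close>, this is the sum of
  \<open>p\<^sub>i \<parallel>G\<^sup>1\<^sup>/\<^sup>2 \<psi>\<^sub>i\<parallel>\<^sup>2\<close>. The relation \<open>has_energy G \<rho> w\<close> says that \<open>Tr (G \<rho>)\<close> is finite and equals \<open>w\<close>.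
\<close>

definition bounded_approximant :: "'h :: complex_hilbert_space unbounded_op \<Rightarrow> real \<Rightarrow> 'h \<Rightarrow> 'h" where
  "bounded_approximant G t =
     (let R = (THE R. is_resolvent G (complex_of_real (- t)) R) in (\<lambda>x. t *\<^sub>R the (G (R x))))"

definition has_energy ::
  "'h :: complex_hilbert_space unbounded_op \<Rightarrow> ('h \<Rightarrow> 'h) \<Rightarrow> real \<Rightarrow> bool" where
  "has_energy G \<rho> w \<longleftrightarrow>
     (\<exists>s. (\<forall>t>0. has_trace (\<rho> \<circ> bounded_approximant G t) (complex_of_real (s t))) \<and>
          (s \<longlongrightarrow> w) at_top)"

text \<open>In the supremum, \<open>m\<^sub>2\<close> and \<open>m\<^sub>1\<close> are the numbers \<open>Tr (\<rho> h\<^sup>2)\<close> and \<open>Tr (\<rho> h)\<close>, which are real because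
  \<open>\<rho>\<close> and \<open>h\<close> are self-adjoint.\<close>

definition gamma_GE ::
  "'h :: complex_hilbert_space unbounded_op \<Rightarrow> real \<Rightarrow> ('h \<Rightarrow> 'h) \<Rightarrow> ereal" where
  "gamma_GE G E h =
     2 * (SUP (\<rho>, m\<^sub>2, m\<^sub>1) \<in> {(\<rho>, m\<^sub>2, m\<^sub>1). density_operator \<rho> \<and> (\<exists>w\<le>E. has_energy G \<rho> w) \<and>
              has_trace (\<rho> \<circ> (h \<circ> h)) (complex_of_real m\<^sub>2) \<and>
              has_trace (\<rho> \<circ> h) (complex_of_real m\<^sub>1)}.
            ereal (sqrt (m\<^sub>2 - m\<^sub>1\<^sup>2)))"

definition Gamma_GE ::
  "'h :: complex_hilbert_space unbounded_op \<Rightarrow> real \<Rightarrow> ('h \<Rightarrow> 'h) set \<Rightarrow> ('h \<Rightarrow> 'h) set \<Rightarrow> ereal" where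
  "Gamma_GE G E M N =
     (SUP (a, b) \<in> sa_unit_ball M \<times> sa_unit_ball N.
        gamma_GE G E (\<lambda>v. (- \<i>) *\<^sub>C commutator a b v))"


section \<open>The Hilbert space of square-summable sequences\<close>

typedef ell2 = "{f :: nat \<Rightarrow> complex. summable (\<lambda>n. (cmod (f n))\<^sup>2)}"
  morphisms ell2_nth Abs_ell2
  by (rule exI[of _ "\<lambda>_. 0"]) simp

lemma summable_ell2: "summable (\<lambda>n. (cmod (ell2_nth x n))\<^sup>2)"
  using ell2_nth[of x] by simp

lemma ell2_eqI: "(\<And>n. ell2_nth x n = ell2_nth y n) \<Longrightarrow> x = y"
  by (simp add: ell2_nth_inject[symmetric] fun_eq_iff)

lemma summable_sq_add:
  assumes "summable (\<lambda>n. (cmod (f n))\<^sup>2)" "summable (\<lambda>n. (cmod (g n))\<^sup>2)"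
  shows "summable (\<lambda>n. (cmod (f n + g n))\<^sup>2)"
proof (rule summable_comparison_test)
  have "(cmod (a + b))\<^sup>2 \<le> 2 * (cmod a)\<^sup>2 + 2 * (cmod b)\<^sup>2" for a b
  proof -
    have "(cmod (a + b))\<^sup>2 \<le> (cmod a + cmod b)\<^sup>2"
      by (simp add: norm_triangle_ineq power_mono)
    also have "\<dots> \<le> 2 * (cmod a)\<^sup>2 + 2 * (cmod b)\<^sup>2"
      using sum_squares_bound[of "cmod a" "cmod b"] by (simp add: power2_sum)
    finally show ?thesis .
  qed
  then show "\<exists>N. \<forall>n\<ge>N. norm ((cmod (f n + g n))\<^sup>2) \<le> 2 * (cmod (f n))\<^sup>2 + 2 * (cmod (g n))\<^sup>2"
    by simp
  show "summable (\<lambda>n. 2 * (cmod (f n))\<^sup>2 + 2 * (cmod (g n))\<^sup>2)"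
    by (intro summable_add summable_mult assms)
qed

lemma summable_sq_mult:
  assumes "summable (\<lambda>n. (cmod (f n))\<^sup>2)"
  shows "summable (\<lambda>n. (cmod (c * f n))\<^sup>2)"
  using summable_mult[OF assms, of "(cmod c)\<^sup>2"] by (simp add: norm_mult power_mult_distrib)

lemma summable_cnj_mult:
  assumes "summable (\<lambda>n. (cmod (f n))\<^sup>2)" "summable (\<lambda>n. (cmod (g n))\<^sup>2)"
  shows "summable (\<lambda>n. cnj (f n) * g n)"
proof (rule summable_comparison_test)
  have "cmod (cnj a * b) \<le> (cmod a)\<^sup>2 + (cmod b)\<^sup>2" for a b
  proof -
    have "2 * (cmod a * cmod b) \<le> (cmod a)\<^sup>2 + (cmod b)\<^sup>2"
      using sum_squares_bound[of "cmod a" "cmod b"] by simp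
    moreover have "0 \<le> cmod a * cmod b" by simp
    ultimately show ?thesis by (simp only: norm_mult complex_mod_cnj)
  qed
  then show "\<exists>N. \<forall>n\<ge>N. norm (cnj (f n) * g n) \<le> (cmod (f n))\<^sup>2 + (cmod (g n))\<^sup>2"
    by blast
  show "summable (\<lambda>n. (cmod (f n))\<^sup>2 + (cmod (g n))\<^sup>2)"
    by (intro summable_add assms)
qed

lemma summable_ell2_cinner: "summable (\<lambda>n. cnj (ell2_nth x n) * ell2_nth y n)"
  by (intro summable_cnj_mult summable_ell2)

instantiation ell2 :: real_inner
begin

definition zero_ell2 :: ell2 where "0 = Abs_ell2 (\<lambda>_. 0)"

definition plus_ell2 :: "ell2 \<Rightarrow> ell2 \<Rightarrow> ell2" where
  "x + y = Abs_ell2 (\<lambda>n. ell2_nth x n + ell2_nth y n)"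

definition scaleR_ell2 :: "real \<Rightarrow> ell2 \<Rightarrow> ell2" where
  "r *\<^sub>R x = Abs_ell2 (\<lambda>n. complex_of_real r * ell2_nth x n)"

definition uminus_ell2 :: "ell2 \<Rightarrow> ell2" where "- x = (- 1) *\<^sub>R (x :: ell2)"

definition minus_ell2 :: "ell2 \<Rightarrow> ell2 \<Rightarrow> ell2" where "x - y = x + - (y :: ell2)"

definition inner_ell2 :: "ell2 \<Rightarrow> ell2 \<Rightarrow> real" where
  "inner x y = Re (\<Sum>n. cnj (ell2_nth x n) * ell2_nth y n)"

definition norm_ell2 :: "ell2 \<Rightarrow> real" where "norm x = sqrt (inner x (x :: ell2))"

definition sgn_ell2 :: "ell2 \<Rightarrow> ell2" where "sgn x = inverse (norm x) *\<^sub>R (x :: ell2)"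

definition dist_ell2 :: "ell2 \<Rightarrow> ell2 \<Rightarrow> real" where "dist x y = norm (x - y :: ell2)"

definition uniformity_ell2 :: "(ell2 \<times> ell2) filter" where
  "uniformity_ell2 = (INF e\<in>{0 <..}. principal {(x, y). dist x y < e})"

definition open_ell2 :: "ell2 set \<Rightarrow> bool" where
  "open_ell2 U = (\<forall>x\<in>U. \<forall>\<^sub>F (x', y) in uniformity. x' = x \<longrightarrow> y \<in> U)"

lemma ell2_nth_zero [simp]: "ell2_nth 0 n = 0"
  by (simp add: zero_ell2_def Abs_ell2_inverse)

lemma ell2_nth_plus [simp]: "ell2_nth (x + y) n = ell2_nth x n + ell2_nth y n"
  by (simp add: plus_ell2_def Abs_ell2_inverse summable_sq_add summable_ell2)

lemma ell2_nth_scaleR [simp]: "ell2_nth (r *\<^sub>R x) n = complex_of_real r * ell2_nth x n"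
  by (simp only: scaleR_ell2_def Abs_ell2_inverse summable_sq_mult summable_ell2 mem_Collect_eq)

lemma ell2_nth_uminus [simp]: "ell2_nth (- x) n = - ell2_nth x n"
  by (simp add: uminus_ell2_def)

lemma ell2_nth_minus [simp]: "ell2_nth (x - y) n = ell2_nth x n - ell2_nth y n"
  by (simp add: minus_ell2_def)

lemma inner_ell2_self: "inner x x = (\<Sum>n. (cmod (ell2_nth x n))\<^sup>2)" for x :: ell2
proof -
  have "cnj z * z = complex_of_real ((cmod z)\<^sup>2)" for z
    by (metis complex_norm_square mult.commute)
  then show ?thesis
    by (simp only: inner_ell2_def suminf_of_real[OF summable_ell2, symmetric] Re_complex_of_real)
qed

lemma norm_ell2_sq: "(norm x)\<^sup>2 = (\<Sum>n. (cmod (ell2_nth x n))\<^sup>2)" for x :: ell2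
  by (simp add: norm_ell2_def inner_ell2_self suminf_nonneg summable_ell2)

lemma ell2_sum_commute:
  "(\<Sum>n. cnj (ell2_nth x n) * ell2_nth y n) = cnj (\<Sum>n. cnj (ell2_nth y n) * ell2_nth x n)"
proof -
  have "(\<lambda>n. cnj (cnj (ell2_nth y n) * ell2_nth x n)) sums cnj (\<Sum>n. cnj (ell2_nth y n) * ell2_nth x n)"
    by (simp only: sums_cnj summable_sums[OF summable_ell2_cinner])
  then show ?thesis
    by (simp add: mult.commute sums_iff)
qed

instance
proof
  fix x y z :: ell2 and a b :: real and U :: "ell2 set"
  show "x + y + z = x + (y + z)" "x + y = y + x" "0 + x = x" "- x + x = 0" "x - y = x + - y"
    by (auto intro!: ell2_eqI)
  show "a *\<^sub>R (x + y) = a *\<^sub>R x + a *\<^sub>R y" "(a + b) *\<^sub>R x = a *\<^sub>R x + b *\<^sub>R x"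
    "a *\<^sub>R b *\<^sub>R x = (a * b) *\<^sub>R x" "1 *\<^sub>R x = x"
    by (auto intro!: ell2_eqI simp: algebra_simps)
  show "sgn x = inverse (norm x) *\<^sub>R x" "dist x y = norm (x - y)" "norm x = sqrt (inner x x)"
    by (simp_all only: sgn_ell2_def dist_ell2_def norm_ell2_def)
  show "uniformity = (INF e\<in>{0 <..}. principal {(x :: ell2, y). dist x y < e})"
    by (rule uniformity_ell2_def)
  show "open U = (\<forall>x\<in>U. \<forall>\<^sub>F (x', y) in uniformity. x' = x \<longrightarrow> y \<in> U)"
    by (rule open_ell2_def)
  show comm: "inner x y = inner y x" for x y :: ell2
    using ell2_sum_commute[of x y] by (simp add: inner_ell2_def)
  have "inner z (x + y) = inner z x + inner z y"
    by (simp add: inner_ell2_def distrib_left suminf_add[OF summable_ell2_cinner summable_ell2_cinner, symmetric])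
  then show "inner (x + y) z = inner x z + inner y z"
    by (simp only: comm[of _ z])
  have "inner y (a *\<^sub>R x) = a * inner y x"
    by (simp add: inner_ell2_def mult.left_commute suminf_mult[OF summable_ell2_cinner])
  then show "inner (a *\<^sub>R x) y = a * inner x y"
    by (simp only: comm[of _ y])
  show "0 \<le> inner x x"
    by (simp add: inner_ell2_self suminf_nonneg summable_ell2)
  show "inner x x = 0 \<longleftrightarrow> x = 0"
    using suminf_eq_zero_iff[OF summable_ell2[of x]]
    by (auto simp: inner_ell2_self intro!: ell2_eqI)
qed

end

lemma sum_ell2_le_norm_sq: "(\<Sum>i<n. (cmod (ell2_nth x i))\<^sup>2) \<le> (norm x)\<^sup>2"
  unfolding norm_ell2_sq by (intro sum_le_suminf summable_ell2) auto

lemma ell2_nth_le_norm: "cmod (ell2_nth x n) \<le> norm x"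
proof (rule power2_le_imp_le)
  show "(cmod (ell2_nth x n))\<^sup>2 \<le> (norm x)\<^sup>2"
    by (rule order_trans[OF member_le_sum sum_ell2_le_norm_sq[of _ "Suc n"]]) auto
qed simp

instance ell2 :: complete_space
proof
  fix X :: "nat \<Rightarrow> ell2"
  assume X: "Cauchy X"
  have dist_nth: "dist (ell2_nth x i) (ell2_nth y i) \<le> dist x y" for x y i
    using ell2_nth_le_norm[of "x - y" i] by (simp add: dist_norm)
  have "Cauchy (\<lambda>k. ell2_nth (X k) i)" for i
  proof (rule metric_CauchyI)
    fix e :: real
    assume "e > 0"
    then obtain N where "\<forall>m\<ge>N. \<forall>n\<ge>N. dist (X m) (X n) < e"
      using X by (meson metric_CauchyD)
    then show "\<exists>N. \<forall>m\<ge>N. \<forall>n\<ge>N. dist (ell2_nth (X m) i) (ell2_nth (X n) i) < e"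
      using dist_nth le_less_trans by blast
  qed
  then have "\<exists>l. (\<lambda>k. ell2_nth (X k) i) \<longlonglongrightarrow> l" for i
    by (simp add: convergent_def[symmetric] Cauchy_convergent)
  then obtain L where L: "(\<lambda>k. ell2_nth (X k) i) \<longlonglongrightarrow> L i" for i
    by metis
  have partial: "(\<Sum>i<n. (cmod (ell2_nth (X m) i - L i))\<^sup>2) \<le> e\<^sup>2"
    if "\<forall>m\<ge>N. \<forall>k\<ge>N. dist (X m) (X k) < e" "m \<ge> N" for e N m n
  proof (rule LIMSEQ_le_const2)
    show "(\<lambda>k. \<Sum>i<n. (cmod (ell2_nth (X m) i - ell2_nth (X k) i))\<^sup>2)
            \<longlonglongrightarrow> (\<Sum>i<n. (cmod (ell2_nth (X m) i - L i))\<^sup>2)"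
      by (intro tendsto_intros L)
    have "(\<Sum>i<n. (cmod (ell2_nth (X m) i - ell2_nth (X k) i))\<^sup>2) \<le> e\<^sup>2" if "k \<ge> N" for k
    proof -
      have "(\<Sum>i<n. (cmod (ell2_nth (X m - X k) i))\<^sup>2) \<le> (norm (X m - X k))\<^sup>2"
        by (rule sum_ell2_le_norm_sq)
      also have "\<dots> \<le> e\<^sup>2"
        using \<open>\<forall>m\<ge>N. \<forall>k\<ge>N. dist (X m) (X k) < e\<close> \<open>m \<ge> N\<close> that
        by (intro power_mono) (auto simp: dist_norm less_imp_le)
      finally show ?thesis by simp
    qed
    then show "\<exists>N. \<forall>k\<ge>N. (\<Sum>i<n. (cmod (ell2_nth (X m) i - ell2_nth (X k) i))\<^sup>2) \<le> e\<^sup>2"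
      by blast
  qed
  have summable_diff: "summable (\<lambda>i. (cmod (ell2_nth (X m) i - L i))\<^sup>2)"
    if "\<forall>m\<ge>N. \<forall>k\<ge>N. dist (X m) (X k) < e" "m \<ge> N" for e N m
    by (rule summableI_nonneg_bounded[of _ "e\<^sup>2"]) (simp, rule partial[OF that])
  obtain N1 where N1: "\<forall>m\<ge>N1. \<forall>k\<ge>N1. dist (X m) (X k) < 1"
    using X by (meson metric_CauchyD zero_less_one)
  have "summable (\<lambda>i. (cmod (ell2_nth (X N1) i + (- 1) * (ell2_nth (X N1) i - L i)))\<^sup>2)"
    by (rule summable_sq_add[OF summable_ell2 summable_sq_mult[OF summable_diff[OF N1 order_refl]]])
  then have "summable (\<lambda>i. (cmod (L i))\<^sup>2)"
    by simp
  then have nth_L: "ell2_nth (Abs_ell2 L) = L"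
    by (simp add: Abs_ell2_inverse)
  have "X \<longlonglongrightarrow> Abs_ell2 L"
  proof (rule metric_LIMSEQ_I)
    fix e :: real
    assume "e > 0"
    then obtain N where N: "\<forall>m\<ge>N. \<forall>k\<ge>N. dist (X m) (X k) < e / 2"
      using X by (meson half_gt_zero metric_CauchyD)
    have "dist (X m) (Abs_ell2 L) < e" if "m \<ge> N" for m
    proof -
      have "(norm (X m - Abs_ell2 L))\<^sup>2 \<le> (e / 2)\<^sup>2"
        using summable_diff[OF N that] partial[OF N that]
        unfolding norm_ell2_sq by (intro suminf_le_const) (simp_all add: nth_L)
      then have "norm (X m - Abs_ell2 L) \<le> e / 2"
        by (rule power2_le_imp_le) (use \<open>e > 0\<close> in simp)
      then show ?thesis
        using \<open>e > 0\<close> by (simp add: dist_norm)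
    qed
    then show "\<exists>N. \<forall>m\<ge>N. dist (X m) (Abs_ell2 L) < e"
      by blast
  qed
  then show "convergent X"
    by (rule convergentI)
qed

instantiation ell2 :: complex_hilbert_space
begin

definition scaleC_ell2 :: "complex \<Rightarrow> ell2 \<Rightarrow> ell2" where
  "c *\<^sub>C x = Abs_ell2 (\<lambda>n. c * ell2_nth x n)"

definition cinner_ell2 :: "ell2 \<Rightarrow> ell2 \<Rightarrow> complex" where
  "cinner x y = (\<Sum>n. cnj (ell2_nth x n) * ell2_nth y n)"

lemma ell2_nth_scaleC [simp]: "ell2_nth (c *\<^sub>C x) n = c * ell2_nth x n"
  by (simp only: scaleC_ell2_def Abs_ell2_inverse summable_sq_mult summable_ell2 mem_Collect_eq)

instance
proof
  fix x y z :: ell2 and a :: real and c d :: complex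
  show "c *\<^sub>C (x + y) = c *\<^sub>C x + c *\<^sub>C y" "(c + d) *\<^sub>C x = c *\<^sub>C x + d *\<^sub>C x"
    "c *\<^sub>C d *\<^sub>C x = (c * d) *\<^sub>C x" "complex_of_real a *\<^sub>C x = a *\<^sub>R x"
    by (auto intro!: ell2_eqI simp: algebra_simps)
  show "cinner x y = cnj (cinner y x)"
    unfolding cinner_ell2_def by (rule ell2_sum_commute)
  show "cinner x (y + z) = cinner x y + cinner x z"
    by (simp add: cinner_ell2_def distrib_left suminf_add[OF summable_ell2_cinner summable_ell2_cinner, symmetric])
  show "cinner x (c *\<^sub>C y) = c * cinner x y"
    by (simp add: cinner_ell2_def mult.left_commute suminf_mult[OF summable_ell2_cinner])
  show "Re (cinner x y) = inner x y"
    by (simp add: cinner_ell2_def inner_ell2_def)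
qed

end

end

theory Submission
  imports Defs
begin

text \<open>
  On \<open>\<ell>\<^sup>2 = \<Oplus>\<^sub>n \<complex>\<^sup>2\<close> let \<open>M\<close> be the diagonal operators and \<open>N = U M U\<close> for a direct sum \<open>U\<close> of
  \<open>2 \<times> 2\<close> reflections. For \<open>a \<in> M\<close>, \<open>b \<in> N\<close> in the unit balls, \<open>[a, b]\<close> is off-diagonal in each block and
  \<open>-[a, b]\<^sup>2\<close> is at most \<open>4 sin\<^sup>2\<theta>\<^sub>n\<close> on block \<open>n\<close>, where \<open>\<theta>\<^sub>n\<close> is the angle between the Pauli matrix \<open>\<sigma>\<^sub>z\<close>
  and its conjugate by \<open>U\<close>; equality holds for signs alternating in each block. Since \<open>[a, b]\<close> anticommutes with
  that \<open>a\<close>, choosing \<open>sin\<^sup>2\<theta>\<^sub>n = 1 - r\<^sub>n\<^sub>+\<^sub>1 \<rightarrow> 1\<close> gives \<open>\<Gamma>(M, N) = 4\<close>. If \<open>G\<close> is diagonal with eigenvalues at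
  least \<open>2 E\<^sub>k / r\<^sub>k\<close> beyond the first \<open>k\<close> blocks, a state of energy at most \<open>E\<^sub>k\<close> has weight at most
  \<open>r\<^sub>k / 2\<close> there, so its variance is at most \<open>4 (1 - r\<^sub>k / 2) \<le> (2 - r\<^sub>k / 2)\<^sup>2\<close>.
  The energies \<open>E\<^sub>k\<close> are at our disposal, which rules out a universal rate \<open>R\<close>: take \<open>E\<^sub>k\<close> with
  \<open>R(E\<^sub>k) < r\<^sub>k\<close>.
\<close>

section \<open>Coordinates in the sequence space\<close>

definition ell2_unit :: "nat \<Rightarrow> ell2" where
  "ell2_unit j = Abs_ell2 (\<lambda>n. if n = j then 1 else 0)"

lemma ell2_nth_Abs:
  "summable (\<lambda>n. (cmod (f n))\<^sup>2) \<Longrightarrow> ell2_nth (Abs_ell2 f) = f"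
  by (simp add: Abs_ell2_inverse)

lemma ell2_nth_sum [simp]: "ell2_nth (sum f A) n = (\<Sum>a\<in>A. ell2_nth (f a) n)"
  by (induction A rule: infinite_finite_induct) auto

lemma ell2_nth_unit [simp]: "ell2_nth (ell2_unit j) n = (if n = j then 1 else 0)"
proof -
  have "summable (\<lambda>n. (cmod (if n = j then 1 else 0))\<^sup>2)"
    by (rule summable_finite[of "{j}"]) auto
  then show ?thesis by (simp add: ell2_unit_def ell2_nth_Abs)
qed

lemma cinner_ell2_unit_left [simp]: "cinner (ell2_unit j) x = ell2_nth x j"
proof -
  have "(\<lambda>n. cnj (ell2_nth (ell2_unit j) n) * ell2_nth x n) = (\<lambda>n. if n = j then ell2_nth x n else 0)"
    by (auto simp: fun_eq_iff)
  then show ?thesis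
    unfolding cinner_ell2_def by (simp add: sums_unique[OF sums_single, symmetric])
qed

lemma cinner_ell2_unit_right [simp]: "cinner x (ell2_unit j) = cnj (ell2_nth x j)"
  by (subst cinner_commute) simp

lemma cinner_self: "cinner x x = complex_of_real ((norm x)\<^sup>2)"
proof -
  have "Im (cinner x x) = 0"
    by (metis cinner_commute complex_cnj_cancel_iff Reals_cnj_iff complex_is_Real_iff)
  then show ?thesis
    by (simp add: complex_eq_iff Re_cinner power2_norm_eq_inner)
qed

lemma norm_ell2_unit [simp]: "norm (ell2_unit j) = 1"
proof -
  have "complex_of_real ((norm (ell2_unit j))\<^sup>2) = 1"
    by (simp only: cinner_self[symmetric]) simp
  then show ?thesis
    by (simp add: abs_square_eq_1 flip: of_real_power)
qed

lemma inj_ell2_unit: "inj ell2_unit"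
proof (rule injI)
  fix i j assume "ell2_unit i = ell2_unit j"
  then have "ell2_nth (ell2_unit i) i = ell2_nth (ell2_unit j) i" by simp
  then show "i = j" by (simp split: if_splits)
qed

lemma norm_ell2_le_bound:
  assumes "\<And>n. cmod (ell2_nth x n) \<le> K * cmod (ell2_nth y n)" "0 \<le> K"
  shows "norm x \<le> K * norm y"
proof (rule power2_le_imp_le)
  have "(norm x)\<^sup>2 \<le> (\<Sum>n. K\<^sup>2 * (cmod (ell2_nth y n))\<^sup>2)"
    unfolding norm_ell2_sq
  proof (intro suminf_le summable_mult summable_ell2)
    show "(cmod (ell2_nth x n))\<^sup>2 \<le> K\<^sup>2 * (cmod (ell2_nth y n))\<^sup>2" for n
      using power_mono[OF assms(1)[of n], of 2] by (simp add: power_mult_distrib)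
  qed
  also have "\<dots> = (K * norm y)\<^sup>2"
    by (simp add: norm_ell2_sq power_mult_distrib suminf_mult summable_ell2)
  finally show "(norm x)\<^sup>2 \<le> (K * norm y)\<^sup>2" .
qed (use assms in simp)

lemma summable_sq_bounded_mult:
  assumes "bounded (range c)" "summable (\<lambda>n. (cmod (f n))\<^sup>2)"
  shows "summable (\<lambda>n. (cmod (c n * f n))\<^sup>2)"
proof -
  obtain K where K: "cmod (c n) \<le> K" for n
    using assms(1) by (auto simp: bounded_iff)
  show ?thesis
  proof (rule summable_comparison_test[OF _ summable_mult[OF assms(2), of "K\<^sup>2"]])
    have "norm ((cmod (c n * f n))\<^sup>2) \<le> K\<^sup>2 * (cmod (f n))\<^sup>2" for n
      using power_mono[OF mult_right_mono[OF K[of n], of "cmod (f n)"], of 2]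
      by (simp add: norm_mult power_mult_distrib)
    then show "\<exists>N. \<forall>n\<ge>N. norm ((cmod (c n * f n))\<^sup>2) \<le> K\<^sup>2 * (cmod (f n))\<^sup>2"
      by blast
  qed
qed

text \<open>The truncations of \<open>x\<close> converge to \<open>x\<close>: the squared error is a
  tail of the convergent series for the squared norm. It serves both the span of the unit vectors
  and the domains of unbounded diagonal operators.\<close>

lemma dense_ell2I:
  assumes "\<And>n x. (\<Sum>j<n. ell2_nth x j *\<^sub>C ell2_unit j) \<in> S"
  shows "closure S = (UNIV :: ell2 set)"
proof -
  have "x \<in> closure S" for x
  proof -
    define s where "s = (\<lambda>n. \<Sum>j<n. ell2_nth x j *\<^sub>C ell2_unit j)"
    have nth_s: "ell2_nth (s n) i = (if i < n then ell2_nth x i else 0)" for n i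
      by (auto simp: s_def if_distrib sum.delta cong: if_cong)
    have "(norm (x - s n))\<^sup>2 = (\<Sum>i. (cmod (ell2_nth x (i + n)))\<^sup>2)" for n
    proof -
      have "(\<Sum>i. (cmod (ell2_nth (x - s n) (i + n)))\<^sup>2) =
          (\<Sum>i. (cmod (ell2_nth (x - s n) i))\<^sup>2) - (\<Sum>i<n. (cmod (ell2_nth (x - s n) i))\<^sup>2)"
        by (rule suminf_minus_initial_segment[OF summable_ell2])
      then show ?thesis
        by (simp add: norm_ell2_sq nth_s)
    qed
    then have "(\<lambda>n. (norm (x - s n))\<^sup>2) \<longlonglongrightarrow> 0"
      using suminf_exist_split2[OF summable_ell2[of x]] by simp
    then have "(\<lambda>n. sqrt ((norm (x - s n))\<^sup>2)) \<longlonglongrightarrow> sqrt 0"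
      by (rule tendsto_real_sqrt)
    then have "(\<lambda>n. norm (s n - x)) \<longlonglongrightarrow> 0"
      by (simp add: norm_minus_commute)
    then have "s \<longlonglongrightarrow> x"
      using LIM_zero_iff tendsto_norm_zero_iff by blast
    moreover have "s n \<in> S" for n
      unfolding s_def by (rule assms)
    ultimately show ?thesis
      unfolding closure_sequential by blast
  qed
  then show ?thesis by auto
qed

lemma orthonormal_basis_ell2_unit: "orthonormal_basis (range ell2_unit)"
proof -
  have "cinner (ell2_unit i) (ell2_unit j) = (if ell2_unit i = ell2_unit j then 1 else 0)" for i j
    using inj_ell2_unit by (simp add: inj_eq)
  moreover have "closure (complex_vector.span (range ell2_unit)) = UNIV"
    by (rule dense_ell2I)
      (rule complex_vector.span_sum, rule complex_vector.span_scale, rule complex_vector.span_base, rule rangeI)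
  ultimately show ?thesis by (auto simp: orthonormal_basis_def)
qed

text \<open>Traces occur below only as hypotheses on the states in a supremum, so
  \<open>has_trace\<close> is only ever evaluated at the standard basis.\<close>

lemma has_trace_imp_has_sum_diagonal:
  assumes "has_trace T t"
  shows "((\<lambda>j. ell2_nth (T (ell2_unit j)) j) has_sum t) UNIV"
proof -
  have "((\<lambda>e. cinner e (T e)) has_sum t) (range ell2_unit)"
    using assms orthonormal_basis_ell2_unit by (auto simp: has_trace_def)
  then show ?thesis
    by (subst (asm) has_sum_reindex[OF inj_ell2_unit]) (simp add: o_def)
qed


section \<open>Diagonal operators and operators on pairs of coordinates\<close>

text \<open>For unbounded \<open>c\<close> the argument of \<open>Abs_ell2\<close> can fail to be
  square summable; coordinate facts therefore carry \<open>bounded (range c)\<close>.\<close>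

definition ell2_diag :: "(nat \<Rightarrow> complex) \<Rightarrow> ell2 \<Rightarrow> ell2" where
  "ell2_diag c x = Abs_ell2 (\<lambda>j. c j * ell2_nth x j)"

lemma ell2_nth_diag:
  "bounded (range c) \<Longrightarrow> ell2_nth (ell2_diag c x) j = c j * ell2_nth x j"
  by (simp add: ell2_diag_def ell2_nth_Abs summable_sq_bounded_mult summable_ell2)

text \<open>The involution exchanging the two coordinates of a block; \<open>j div 2\<close> is the
  number of the block.\<close>

definition partner :: "nat \<Rightarrow> nat" where
  "partner j = (if even j then Suc j else j - 1)"

lemma partner_partner [simp]: "partner (partner j) = j"
  by (auto simp: partner_def elim!: oddE)

lemma even_partner [simp]: "even (partner j) \<longleftrightarrow> odd j"
  by (auto simp: partner_def elim!: oddE)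

lemma partner_div_2 [simp]: "partner j div 2 = j div 2"
  by (auto simp: partner_def elim!: oddE)

lemma bij_partner: "bij partner"
  by (rule o_bij[of partner]) auto

lemma has_sum_reindex_partner:
  "((\<lambda>j. f (partner j)) has_sum s) UNIV \<longleftrightarrow> (f has_sum s) UNIV"
  by (rule has_sum_reindex_bij_betw[OF bij_partner])

definition ell2_swap :: "ell2 \<Rightarrow> ell2" where
  "ell2_swap x = Abs_ell2 (\<lambda>j. ell2_nth x (partner j))"

text \<open>The terms are non-negative, so the ordered series is also an unordered sum, and that is
  invariant under the bijection \<open>partner\<close>.\<close>

lemma sums_ell2_partner: "(\<lambda>j. (cmod (ell2_nth x (partner j)))\<^sup>2) sums (norm x)\<^sup>2"
proof -
  have "(\<lambda>j. (cmod (ell2_nth x j))\<^sup>2) sums (norm x)\<^sup>2"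
    by (simp add: norm_ell2_sq summable_ell2 summable_sums)
  then have "((\<lambda>j. (cmod (ell2_nth x j))\<^sup>2) has_sum (norm x)\<^sup>2) UNIV"
    by (intro sums_nonneg_imp_has_sum) auto
  then have "((\<lambda>j. (cmod (ell2_nth x (partner j)))\<^sup>2) has_sum (norm x)\<^sup>2) UNIV"
    by (subst has_sum_reindex_partner[of "\<lambda>j. (cmod (ell2_nth x j))\<^sup>2"])
  then show ?thesis by (rule has_sum_imp_sums)
qed

lemma ell2_nth_swap [simp]: "ell2_nth (ell2_swap x) j = ell2_nth x (partner j)"
  using sums_ell2_partner[of x] by (simp add: ell2_swap_def ell2_nth_Abs sums_iff)

lemma norm_ell2_swap [simp]: "norm (ell2_swap x) = norm x"
proof -
  have "(norm (ell2_swap x))\<^sup>2 = (norm x)\<^sup>2"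
    using sums_ell2_partner[of x] by (simp add: norm_ell2_sq[of "ell2_swap x"] sums_iff)
  then show ?thesis by simp
qed

section \<open>Bounded complex-linear operators and block operators\<close>

lemma bounded_op_ell2I:
  assumes "\<And>x y. T (x + y) = T x + T y" "\<And>c x. T (c *\<^sub>C x) = c *\<^sub>C T x"
    and "\<And>x. norm (T x) \<le> K * norm x"
  shows "bounded_op T"
proof -
  have "bounded_linear T"
    by (rule bounded_linear_intro[of _ K]) (use assms in \<open>simp_all add: mult.commute flip: scaleC_of_real\<close>)
  then show ?thesis using assms by (simp add: bounded_op_def)
qed

lemma bounded_op_linear: "bounded_op T \<Longrightarrow> linear T"
  by (simp add: bounded_op_def bounded_linear.linear)

lemma bounded_op_scaleC: "bounded_op T \<Longrightarrow> T (c *\<^sub>C x) = c *\<^sub>C T x"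
  by (simp add: bounded_op_def)

lemma bounded_op_compose: "bounded_op S \<Longrightarrow> bounded_op T \<Longrightarrow> bounded_op (S \<circ> T)"
  unfolding bounded_op_def by (auto simp: o_def intro: bounded_linear_compose)

text \<open>With respect to the pairs \<open>{2n, 2n + 1}\<close> of coordinates this is a direct sum of \<open>2 \<times> 2\<close> matrices
  with diagonal entries \<open>p\<close> and off-diagonal entries \<open>q\<close>.\<close>

definition pair_op :: "(nat \<Rightarrow> complex) \<Rightarrow> (nat \<Rightarrow> complex) \<Rightarrow> ell2 \<Rightarrow> ell2" where
  "pair_op p q x = ell2_diag p x + ell2_diag q (ell2_swap x)"

lemma ell2_nth_pair_op:
  assumes "bounded (range p)" "bounded (range q)"
  shows "ell2_nth (pair_op p q x) j = p j * ell2_nth x j + q j * ell2_nth x (partner j)"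
  using assms by (simp add: pair_op_def ell2_nth_diag)

lemma norm_ell2_diag_le:
  assumes "\<And>j. cmod (c j) \<le> K"
  shows "norm (ell2_diag c x) \<le> K * norm x"
proof (rule norm_ell2_le_bound)
  have "bounded (range c)" using assms by (auto simp: bounded_iff)
  then show "cmod (ell2_nth (ell2_diag c x) n) \<le> K * cmod (ell2_nth x n)" for n
    by (simp add: ell2_nth_diag norm_mult mult_right_mono assms)
  show "0 \<le> K" using assms[of 0] norm_ge_zero order_trans by blast
qed

lemma bounded_op_pair_op:
  assumes "bounded (range p)" "bounded (range q)"
  shows "bounded_op (pair_op p q)"
proof -
  obtain K where K: "cmod (p j) \<le> K" for j
    using assms(1) by (auto simp: bounded_iff)
  obtain L where L: "cmod (q j) \<le> L" for j
    using assms(2) by (auto simp: bounded_iff)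
  show ?thesis
  proof (rule bounded_op_ell2I)
    show "pair_op p q (x + y) = pair_op p q x + pair_op p q y" for x y
      by (rule ell2_eqI) (simp add: ell2_nth_pair_op assms algebra_simps)
    show "pair_op p q (c *\<^sub>C x) = c *\<^sub>C pair_op p q x" for c x
      by (rule ell2_eqI) (simp add: ell2_nth_pair_op assms algebra_simps)
    have "norm (pair_op p q x) \<le> K * norm x + L * norm (ell2_swap x)" for x
      unfolding pair_op_def
      by (intro norm_triangle_mono norm_ell2_diag_le K L)
    then show "norm (pair_op p q x) \<le> (K + L) * norm x" for x
      by (simp add: algebra_simps)
  qed
qed

section \<open>Stability of bounded coefficient sequences\<close>

lemma bounded_range_mult:
  fixes f g :: "nat \<Rightarrow> complex"
  assumes "bounded (range f)" "bounded (range g)"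
  shows "bounded (range (\<lambda>j. f j * g j))"
proof -
  obtain K L where K: "\<And>j. cmod (f j) \<le> K" and L: "\<And>j. cmod (g j) \<le> L"
    using assms by (auto simp: bounded_iff)
  have "cmod (f j * g j) \<le> K * L" for j
    unfolding norm_mult by (intro mult_mono K L order_trans[OF norm_ge_zero K]) auto
  then show ?thesis by (auto simp: bounded_iff)
qed

lemma bounded_range_partner:
  "bounded (range f) \<Longrightarrow> bounded (range (\<lambda>j. f (partner j)))"
  by (rule bounded_subset) auto

lemma bounded_range_plus:
  fixes f g :: "nat \<Rightarrow> complex"
  assumes "bounded (range f)" "bounded (range g)"
  shows "bounded (range (\<lambda>j. f j + g j))"
  by (rule bounded_plus_comp[OF assms])

lemma bounded_range_minus:
  fixes f g :: "nat \<Rightarrow> complex"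
  assumes "bounded (range f)" "bounded (range g)"
  shows "bounded (range (\<lambda>j. f j - g j))"
  by (rule bounded_minus_comp[OF assms])

lemma bounded_range_const: "bounded (range (\<lambda>j :: nat. c :: complex))"
  by (auto simp: bounded_iff)

lemmas bounded_range_intros = bounded_range_const bounded_range_mult bounded_range_partner
  bounded_range_plus bounded_range_minus

lemma bounded_range_cnj:
  "bounded (range f) \<Longrightarrow> bounded (range (\<lambda>j. cnj (f j)))"
  by (auto simp: bounded_iff)

text \<open>The off-diagonal entry of row \<open>j\<close> stands in column
  \<open>partner j\<close>, so transposition moves the argument of \<open>q\<close> to
  \<open>partner j\<close>. For that part the identity is a reindexing of the inner product by
  \<open>partner\<close>.\<close>

lemma is_adjoint_pair_op:
  assumes "bounded (range p)" "bounded (range q)"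
  shows "is_adjoint (pair_op p q) (pair_op (\<lambda>j. cnj (p j)) (\<lambda>j. cnj (q (partner j))))"
  unfolding is_adjoint_def
proof (intro allI)
  fix x y
  \<comment> \<open>The inner product is an ordered series; absolute convergence, from
    \<open>2 * |u * v| <= |u|^2 + |v|^2\<close>, makes it an unordered sum that can be
    reindexed.\<close>
  have has_sum: "((\<lambda>j. cnj (ell2_nth u j) * ell2_nth v j) has_sum cinner u v) UNIV" for u v
  proof (rule norm_summable_imp_has_sum)
    show "(\<lambda>j. cnj (ell2_nth u j) * ell2_nth v j) sums cinner u v"
      by (simp add: cinner_ell2_def summable_ell2_cinner summable_sums)
    show "summable (\<lambda>j. norm (cnj (ell2_nth u j) * ell2_nth v j))"
    proof (rule summable_comparison_test[OF _ summable_add[OF summable_ell2[of u] summable_ell2[of v]]])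
      have "norm (norm (cnj (ell2_nth u j) * ell2_nth v j))
          \<le> (cmod (ell2_nth u j))\<^sup>2 + (cmod (ell2_nth v j))\<^sup>2" for j
      proof -
        have "2 * (cmod (ell2_nth u j) * cmod (ell2_nth v j)) \<le> (cmod (ell2_nth u j))\<^sup>2 + (cmod (ell2_nth v j))\<^sup>2"
          using sum_squares_bound[of "cmod (ell2_nth u j)" "cmod (ell2_nth v j)"] by simp
        moreover have "0 \<le> cmod (ell2_nth u j) * cmod (ell2_nth v j)" by simp
        ultimately show ?thesis
          by (simp only: norm_mult complex_mod_cnj real_norm_def abs_mult abs_norm_cancel)
      qed
      then show "\<exists>N. \<forall>j\<ge>N. norm (norm (cnj (ell2_nth u j) * ell2_nth v j))
          \<le> (cmod (ell2_nth u j))\<^sup>2 + (cmod (ell2_nth v j))\<^sup>2" by blast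
    qed
  qed
  define f where "f = (\<lambda>j. cnj (ell2_nth x j) * (cnj (q (partner j)) * ell2_nth y (partner j)))"
  have "(f has_sum cinner x (ell2_diag (\<lambda>j. cnj (q (partner j))) (ell2_swap y))) UNIV"
    using has_sum[of x "ell2_diag (\<lambda>j. cnj (q (partner j))) (ell2_swap y)"]
    by (simp add: ell2_nth_diag bounded_range_cnj bounded_range_partner assms f_def)
  then have "((\<lambda>j. f (partner j)) has_sum cinner x (ell2_diag (\<lambda>j. cnj (q (partner j))) (ell2_swap y))) UNIV"
    by (simp only: has_sum_reindex_partner)
  moreover have "((\<lambda>j. f (partner j)) has_sum cinner (ell2_diag q (ell2_swap x)) y) UNIV"
    using has_sum[of "ell2_diag q (ell2_swap x)" y] assms
    by (simp add: ell2_nth_diag f_def mult_ac)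
  ultimately have off: "cinner (ell2_diag q (ell2_swap x)) y
      = cinner x (ell2_diag (\<lambda>j. cnj (q (partner j))) (ell2_swap y))"
    using has_sum_unique by blast
  have diag: "cinner (ell2_diag p x) y = cinner x (ell2_diag (\<lambda>j. cnj (p j)) y)"
    unfolding cinner_ell2_def by (simp add: ell2_nth_diag bounded_range_cnj assms mult_ac)
  have "cinner (u + v) w = cinner u w + cinner v w" for u v w :: ell2
    by (simp only: cinner_commute[of _ w] cinner_add_right complex_cnj_add)
  then show "cinner (pair_op p q x) y = cinner x (pair_op (\<lambda>j. cnj (p j)) (\<lambda>j. cnj (q (partner j))) y)"
    by (simp add: pair_op_def cinner_add_right off diag)
qed


section \<open>Compactness of Hilbert cubes\<close>

text \<open>Tychonoff gives compactness in the product topology, and dominated convergence shows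
  that on the cube coordinatewise convergence implies norm convergence.\<close>

lemma compact_hilbert_cube:
  fixes d :: "nat \<Rightarrow> real"
  assumes d: "summable (\<lambda>j. (d j)\<^sup>2)"
  shows "compact {x. \<forall>j. cmod (ell2_nth x j) \<le> d j}"
proof -
  define K where "K = {f :: nat \<Rightarrow> complex. \<forall>j. cmod (f j) \<le> d j}"
  have "compactin (product_topology (\<lambda>_. euclidean) UNIV) (\<Pi>\<^sub>E j\<in>UNIV. cball (0 :: complex) (d j))"
    by (simp add: compactin_PiE)
  moreover have "(\<Pi>\<^sub>E j\<in>UNIV. cball (0 :: complex) (d j)) = K"
    by (auto simp: K_def PiE_def Pi_def)
  ultimately have "compact K"
    by (simp add: euclidean_product_topology)
  have le: "(cmod (f j))\<^sup>2 \<le> (d j)\<^sup>2" if "f \<in> K" for f j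
    using that by (intro power_mono) (auto simp: K_def)
  have summable_K: "summable (\<lambda>j. (cmod (f j))\<^sup>2)" if "f \<in> K" for f
    by (rule summable_comparison_test[OF _ d]) (use le[OF that] in auto)
  have "continuous_on K Abs_ell2"
    unfolding continuous_on_sequentially
  proof (intro allI ballI impI, elim conjE)
    fix F f assume f: "f \<in> K" and F: "\<forall>n. F n \<in> K" and lim: "F \<longlonglongrightarrow> f"
    have lim_nth: "(\<lambda>n. F n j) \<longlonglongrightarrow> f j" for j
      by (rule continuous_on_tendsto_compose[OF continuous_on_product_coordinates[of j] lim]) auto
    have bound: "norm ((cmod (F n j - f j))\<^sup>2) \<le> 4 * (d j)\<^sup>2" for n j
    proof -
      have "cmod (F n j) \<le> d j" "cmod (f j) \<le> d j"
        using f F by (auto simp: K_def)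
      then have "cmod (F n j - f j) \<le> 2 * d j"
        using norm_triangle_ineq4[of "F n j" "f j"] by linarith
      then have "(cmod (F n j - f j))\<^sup>2 \<le> (2 * d j)\<^sup>2"
        by (intro power_mono) auto
      then show ?thesis by (simp add: power_mult_distrib)
    qed
    have lim_sq: "(\<lambda>n. (cmod (F n j - f j))\<^sup>2) \<longlonglongrightarrow> 0" for j
    proof -
      have "(\<lambda>n. (cmod (F n j - f j))\<^sup>2) \<longlonglongrightarrow> (cmod (f j - f j))\<^sup>2"
        by (intro tendsto_intros lim_nth)
      then show ?thesis by simp
    qed
    \<comment> \<open>Tannery's theorem: limit and sum are exchanged under the summable majorant
      from \<open>bound\<close>.\<close>
    have "(\<lambda>n. \<Sum>j. (cmod (F n j - f j))\<^sup>2) \<longlonglongrightarrow> (\<Sum>j. 0)"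
      by (rule conjunct2[OF conjunct2[OF tannerys_theorem[where M = "\<lambda>j. 4 * (d j)\<^sup>2", OF lim_sq]]])
        (use bound d in \<open>auto intro!: summable_mult always_eventually\<close>)
    moreover have "(norm (Abs_ell2 (F n) - Abs_ell2 f))\<^sup>2 = (\<Sum>j. (cmod (F n j - f j))\<^sup>2)" for n
      using f F by (simp add: norm_ell2_sq ell2_nth_Abs summable_K)
    ultimately have "(\<lambda>n. (norm (Abs_ell2 (F n) - Abs_ell2 f))\<^sup>2) \<longlonglongrightarrow> 0"
      by simp
    then have "(\<lambda>n. sqrt ((norm (Abs_ell2 (F n) - Abs_ell2 f))\<^sup>2)) \<longlonglongrightarrow> sqrt 0"
      by (rule tendsto_real_sqrt)
    then have "(\<lambda>n. norm (Abs_ell2 (F n) - Abs_ell2 f)) \<longlonglongrightarrow> 0"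
      by simp
    then show "(Abs_ell2 \<circ> F) \<longlonglongrightarrow> Abs_ell2 f"
      unfolding o_def using LIM_zero_iff tendsto_norm_zero_iff by blast
  qed
  then have "compact (Abs_ell2 ` K)"
    using \<open>compact K\<close> by (rule compact_continuous_image)
  moreover have "Abs_ell2 ` K = {x. \<forall>j. cmod (ell2_nth x j) \<le> d j}"
  proof (intro equalityI subsetI)
    show "x \<in> {x. \<forall>j. cmod (ell2_nth x j) \<le> d j}" if "x \<in> Abs_ell2 ` K" for x
      using that by (auto simp: ell2_nth_Abs summable_K) (simp add: K_def)
    show "x \<in> Abs_ell2 ` K" if "x \<in> {x. \<forall>j. cmod (ell2_nth x j) \<le> d j}" for x
      using that ell2_nth_inverse[of x] by (intro image_eqI[of _ _ "ell2_nth x"]) (auto simp: K_def)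
  qed
  ultimately show ?thesis by simp
qed


section \<open>Unbounded diagonal operators\<close>

text \<open>Multiplication by \<open>g\<close> on its maximal domain, which makes it self-adjoint
  and not merely symmetric.\<close>

definition diag_unbounded :: "(nat \<Rightarrow> real) \<Rightarrow> ell2 unbounded_op" where
  "diag_unbounded g x =
     (if summable (\<lambda>j. (cmod (complex_of_real (g j) * ell2_nth x j))\<^sup>2)
      then Some (Abs_ell2 (\<lambda>j. complex_of_real (g j) * ell2_nth x j)) else None)"

text \<open>The right side implies membership in the domain, since the coordinates of
  \<open>y\<close> are square summable by type.\<close>

lemma diag_unbounded_eq_Some_iff:
  "diag_unbounded g x = Some y \<longleftrightarrow> (\<forall>j. ell2_nth y j = complex_of_real (g j) * ell2_nth x j)"
proof
  assume y: "\<forall>j. ell2_nth y j = complex_of_real (g j) * ell2_nth x j"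
  then have "summable (\<lambda>j. (cmod (complex_of_real (g j) * ell2_nth x j))\<^sup>2)"
    using summable_ell2[of y] by simp
  with y show "diag_unbounded g x = Some y"
    by (auto simp: diag_unbounded_def ell2_nth_Abs intro!: ell2_eqI)
qed (auto simp: diag_unbounded_def ell2_nth_Abs split: if_splits)

lemma dom_diag_unbounded_iff:
  "x \<in> dom (diag_unbounded g) \<longleftrightarrow> (\<exists>y. \<forall>j. ell2_nth y j = complex_of_real (g j) * ell2_nth x j)"
  by (simp add: dom_def flip: diag_unbounded_eq_Some_iff)

lemma ell2_nth_diag_unbounded:
  assumes "x \<in> dom (diag_unbounded g)"
  shows "ell2_nth (the (diag_unbounded g x)) j = complex_of_real (g j) * ell2_nth x j"
  using assms diag_unbounded_eq_Some_iff by fastforce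

lemma dom_diag_unboundedI:
  "(\<And>j. ell2_nth y j = complex_of_real (g j) * ell2_nth x j) \<Longrightarrow> x \<in> dom (diag_unbounded g)"
  by (auto simp: dom_diag_unbounded_iff)

lemma dom_diag_unbounded_add:
  assumes "x \<in> dom (diag_unbounded g)" "y \<in> dom (diag_unbounded g)"
  shows "x + y \<in> dom (diag_unbounded g)"
  by (rule dom_diag_unboundedI[of "the (diag_unbounded g x) + the (diag_unbounded g y)"])
    (simp add: ell2_nth_diag_unbounded assms distrib_left)

lemma dom_diag_unbounded_scaleC:
  assumes "x \<in> dom (diag_unbounded g)"
  shows "c *\<^sub>C x \<in> dom (diag_unbounded g)"
  by (rule dom_diag_unboundedI[of "c *\<^sub>C the (diag_unbounded g x)"])
    (simp add: ell2_nth_diag_unbounded assms)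

lemma ell2_unit_in_dom_diag_unbounded: "ell2_unit j \<in> dom (diag_unbounded g)"
  by (rule dom_diag_unboundedI[of "complex_of_real (g j) *\<^sub>C ell2_unit j"]) auto

lemma subspace_dom_diag_unbounded: "complex_vector.subspace (dom (diag_unbounded g))"
proof -
  have "0 \<in> dom (diag_unbounded g)"
    by (rule dom_diag_unboundedI[of 0]) simp
  then show ?thesis
    by (intro complex_vector.subspaceI dom_diag_unbounded_add dom_diag_unbounded_scaleC)
qed

lemma densely_defined_linear_diag_unbounded: "densely_defined_linear (diag_unbounded g)"
  unfolding densely_defined_linear_def
proof (intro conjI ballI allI)
  show "complex_vector.subspace (dom (diag_unbounded g))"
    by (rule subspace_dom_diag_unbounded)
  show "closure (dom (diag_unbounded g)) = UNIV"
    by (rule dense_ell2I)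
      (intro complex_vector.subspace_sum[OF subspace_dom_diag_unbounded]
        dom_diag_unbounded_scaleC ell2_unit_in_dom_diag_unbounded)
  fix x y c assume "x \<in> dom (diag_unbounded g)" "y \<in> dom (diag_unbounded g)"
  then show "the (diag_unbounded g (c *\<^sub>C x + y)) =
      c *\<^sub>C the (diag_unbounded g x) + the (diag_unbounded g y)"
    by (intro ell2_eqI)
      (simp add: ell2_nth_diag_unbounded dom_diag_unbounded_add dom_diag_unbounded_scaleC distrib_left)
qed

text \<open>Testing the adjoint relation on \<open>ell2_unit j\<close> determines coordinate
  \<open>j\<close> of \<open>z\<close>; by \<open>diag_unbounded_eq_Some_iff\<close> this already
  places \<open>y\<close> in the domain.\<close>

lemma unbounded_selfadjoint_diag_unbounded: "unbounded_selfadjoint (diag_unbounded g)"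
  unfolding unbounded_selfadjoint_def
proof (intro conjI allI iffI densely_defined_linear_diag_unbounded ballI)
  fix y z assume adj: "\<forall>x\<in>dom (diag_unbounded g). cinner (the (diag_unbounded g x)) y = cinner x z"
  have "ell2_nth z j = complex_of_real (g j) * ell2_nth y j" for j
  proof -
    have "the (diag_unbounded g (ell2_unit j)) = complex_of_real (g j) *\<^sub>C ell2_unit j"
      by (rule ell2_eqI) (simp add: ell2_nth_diag_unbounded ell2_unit_in_dom_diag_unbounded)
    then have "cinner (complex_of_real (g j) *\<^sub>C ell2_unit j) y = ell2_nth z j"
      using adj[rule_format, OF ell2_unit_in_dom_diag_unbounded[of j g]] by simp
    moreover have "cinner (complex_of_real (g j) *\<^sub>C ell2_unit j) y = complex_of_real (g j) * ell2_nth y j"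
      by (subst cinner_commute) (simp add: cinner_scaleC_right)
    ultimately show ?thesis by simp
  qed
  then show "diag_unbounded g y = Some z"
    by (simp add: diag_unbounded_eq_Some_iff)
next
  fix x y z assume "diag_unbounded g y = Some z" "x \<in> dom (diag_unbounded g)"
  then show "cinner (the (diag_unbounded g x)) y = cinner x z"
    by (simp add: cinner_ell2_def ell2_nth_diag_unbounded diag_unbounded_eq_Some_iff mult_ac)
qed

lemma positive_selfadjoint_diag_unbounded:
  assumes "\<And>j. 0 \<le> g j"
  shows "positive_selfadjoint (diag_unbounded g)"
  unfolding positive_selfadjoint_def
proof (intro conjI unbounded_selfadjoint_diag_unbounded ballI)
  fix x assume x: "x \<in> dom (diag_unbounded g)"
  let ?f = "\<lambda>j. cnj (ell2_nth x j) * ell2_nth (the (diag_unbounded g x)) j"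
  have "Re (cinner x (the (diag_unbounded g x))) = (\<Sum>j. Re (?f j))"
    unfolding cinner_ell2_def
    by (rule Re_suminf[OF summable_ell2_cinner])
  also have "\<dots> \<ge> 0"
  proof (rule suminf_nonneg[OF summable_Re[OF summable_ell2_cinner]])
    have "?f j = complex_of_real (g j) * (cnj (ell2_nth x j) * ell2_nth x j)" for j
      by (simp add: ell2_nth_diag_unbounded[OF x])
    also have "\<dots> j = complex_of_real (g j * (cmod (ell2_nth x j))\<^sup>2)" for j
      by (simp only: of_real_mult complex_norm_square mult.commute[of "cnj _"])
    finally show "0 \<le> Re (?f j)" for j
      by (simp add: assms)
  qed
  finally show "0 \<le> Re (cinner x (the (diag_unbounded g x)))" .
qed

section \<open>Resolvents and bounded approximants\<close>

lemma cmod_diag_diff_ge: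
  assumes "0 \<le> g" "Re z < 0"
  shows "g \<le> cmod (complex_of_real g - z)" "- Re z \<le> cmod (complex_of_real g - z)"
  using assms complex_Re_le_cmod[of "complex_of_real g - z"] by auto

lemma bounded_resolvent_coeffs:
  assumes "\<And>j. 0 \<le> g j" "Re z < 0"
  shows "bounded (range (\<lambda>j. 1 / (complex_of_real (g j) - z)))"
proof -
  have "cmod (1 / (complex_of_real (g j) - z)) \<le> 1 / (- Re z)" for j
    unfolding norm_divide norm_one
    by (rule frac_le) (use cmod_diag_diff_ge(2)[OF assms(1)[of j] assms(2)] assms(2) in auto)
  then show ?thesis by (auto simp: bounded_iff)
qed

text \<open>The half-plane \<open>Re z < 0\<close> covers all uses: \<open>-1\<close> for
  compactness, \<open>-t\<close> for the approximants, and the points to be kept out of the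
  spectrum.\<close>

lemma is_resolvent_diag_unbounded:
  assumes g: "\<And>j. 0 \<le> g j" and z: "Re z < 0"
  shows "is_resolvent (diag_unbounded g) z (ell2_diag (\<lambda>j. 1 / (complex_of_real (g j) - z)))"
    (is "is_resolvent ?G z (ell2_diag ?c)")
proof -
  have c: "bounded (range ?c)"
    by (rule bounded_resolvent_coeffs[OF assms])
  have nz: "complex_of_real (g j) - z \<noteq> 0" for j
    using g[of j] z by (auto simp: complex_eq_iff)
  \<comment> \<open>Since \<open>g / (g - z) = 1 + z / (g - z)\<close>, these bounded coefficients
    describe the operator applied after its resolvent, which shows that the resolvent maps into the
    domain.\<close>
  have cg: "bounded (range (\<lambda>j. 1 + z * ?c j))"
    by (intro bounded_range_intros c)
  have dom: "ell2_diag ?c y \<in> dom ?G" for y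
    by (rule dom_diag_unboundedI[of "ell2_diag (\<lambda>j. 1 + z * ?c j) y"],
        simp only: ell2_nth_diag[OF c] ell2_nth_diag[OF cg])
      (use nz in \<open>simp add: field_simps\<close>)
  have cancel: "complex_of_real (g j) * (?c j * w) - z * (?c j * w) = w" for j w
    using nz[of j] by (simp only: left_diff_distrib[symmetric]) simp
  obtain K where K: "\<And>j. cmod (?c j) \<le> K"
    using c by (auto simp: bounded_iff)
  have "bounded_op (ell2_diag ?c)"
    by (rule bounded_op_ell2I[of _ K])
      (auto intro!: ell2_eqI norm_ell2_diag_le K simp: ell2_nth_diag c algebra_simps add_divide_distrib)
  moreover have "the (?G (ell2_diag ?c y)) - z *\<^sub>C ell2_diag ?c y = y" for y
    by (rule ell2_eqI)
      (simp only: ell2_nth_minus ell2_nth_scaleC ell2_nth_diag_unbounded[OF dom] ell2_nth_diag[OF c] cancel)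
  moreover have "ell2_diag ?c (the (?G x) - z *\<^sub>C x) = x" if "x \<in> dom ?G" for x
    by (rule ell2_eqI)
      (use nz in \<open>simp add: ell2_nth_diag_unbounded that ell2_nth_diag c field_simps\<close>)
  ultimately show ?thesis
    by (simp add: is_resolvent_def dom)
qed

lemma is_resolvent_unique:
  assumes "is_resolvent G z R" "is_resolvent G z R'"
  shows "R = R'"
proof
  fix y
  have "R y \<in> dom G" "the (G (R y)) - z *\<^sub>C R y = y"
    using assms(1) by (auto simp: is_resolvent_def)
  then show "R y = R' y"
    using assms(2) unfolding is_resolvent_def by metis
qed

text \<open>Basis vectors suffice, because energies are computed from the diagonal of
  \<open>\<rho> \<circ> bounded_approximant G t\<close>.\<close>

lemma bounded_approximant_diag_unbounded:
  assumes g: "\<And>j. 0 \<le> g j" and t: "0 < t"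
  shows "bounded_approximant (diag_unbounded g) t (ell2_unit j)
    = complex_of_real (t * (g j / (g j + t))) *\<^sub>C ell2_unit j"
proof -
  define c where "c = (\<lambda>j. 1 / (complex_of_real (g j) - complex_of_real (- t)))"
  have R: "is_resolvent (diag_unbounded g) (complex_of_real (- t)) (ell2_diag c)"
    unfolding c_def by (rule is_resolvent_diag_unbounded) (use assms in auto)
  then have "(THE R. is_resolvent (diag_unbounded g) (complex_of_real (- t)) R) = ell2_diag c"
    using is_resolvent_unique by blast
  then have approx: "bounded_approximant (diag_unbounded g) t x = t *\<^sub>R the (diag_unbounded g (ell2_diag c x))" for x
    by (simp add: bounded_approximant_def)
  have c: "bounded (range c)"
    unfolding c_def by (rule bounded_resolvent_coeffs) (use assms in auto)
  have dom: "ell2_diag c x \<in> dom (diag_unbounded g)" for x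
    using R by (simp add: is_resolvent_def)
  have "c j = complex_of_real (1 / (g j + t))"
    by (simp add: c_def)
  then show ?thesis
    by (intro ell2_eqI) (simp add: approx ell2_nth_diag_unbounded dom ell2_nth_diag c)
qed

text \<open>The resolvent at \<open>-1\<close> maps the unit ball into the Hilbert cube with sides
  \<open>1 / (g j + 1)\<close>.\<close>

lemma compact_resolvent_diag_unbounded:
  assumes g: "\<And>j. 0 \<le> g j" and summable: "summable (\<lambda>j. (1 / (g j + 1))\<^sup>2)"
  shows "compact_resolvent (diag_unbounded g)"
proof -
  define c where "c = (\<lambda>j. 1 / (complex_of_real (g j) - (- 1)))"
  have R: "is_resolvent (diag_unbounded g) (- 1) (ell2_diag c)"
    unfolding c_def by (rule is_resolvent_diag_unbounded) (use assms in auto)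
  have c: "bounded (range c)"
    unfolding c_def by (rule bounded_resolvent_coeffs) (use assms in auto)
  let ?Q = "{x. \<forall>j. cmod (ell2_nth x j) \<le> 1 / (g j + 1)}"
  have cmod_c: "cmod (c j) = 1 / (g j + 1)" for j
  proof -
    have "c j = complex_of_real (1 / (g j + 1))" by (simp add: c_def)
    then show ?thesis using g[of j] by (simp only: norm_of_real) simp
  qed
  have "ell2_diag c ` cball 0 1 \<subseteq> ?Q"
  proof clarify
    fix x j assume "x \<in> cball (0 :: ell2) 1"
    then have "cmod (ell2_nth x j) \<le> 1"
      using ell2_nth_le_norm[of x j] by simp
    then show "cmod (ell2_nth (ell2_diag c x) j) \<le> 1 / (g j + 1)"
      using g[of j] by (simp add: ell2_nth_diag c norm_mult cmod_c mult_left_le divide_right_mono)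
  qed
  moreover have "compact ?Q"
    by (rule compact_hilbert_cube[OF summable])
  ultimately have "closure (ell2_diag c ` cball 0 1) \<subseteq> ?Q"
    by (simp add: closure_minimal compact_imp_closed)
  moreover have "compact (?Q \<inter> closure (ell2_diag c ` cball 0 1))"
    by (rule compact_Int_closed[OF \<open>compact ?Q\<close> closed_closure])
  ultimately have "compact (closure (ell2_diag c ` cball 0 1))"
    by (simp only: Int_absorb1)
  then show ?thesis
    using R unfolding compact_resolvent_def compact_op_def is_resolvent_def by blast
qed

section \<open>Eigenvalues and spectrum of diagonal operators\<close>

lemma eigenspace_diag_unbounded_iff:
  "x \<in> eigenspace (diag_unbounded g) \<mu> \<longleftrightarrow> (\<forall>j. ell2_nth x j \<noteq> 0 \<longrightarrow> g j = \<mu>)"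
  by (auto simp: eigenspace_def diag_unbounded_eq_Some_iff)

lemma is_eigenvalue_diag_unbounded_iff:
  "is_eigenvalue (diag_unbounded g) \<mu> \<longleftrightarrow> \<mu> \<in> range g"
proof
  assume "is_eigenvalue (diag_unbounded g) \<mu>"
  then obtain x where x: "x \<in> eigenspace (diag_unbounded g) \<mu>" "x \<noteq> 0"
    by (auto simp: is_eigenvalue_def)
  then obtain j where "ell2_nth x j \<noteq> 0"
    using ell2_eqI[of x 0] by auto
  then show "\<mu> \<in> range g"
    using x by (auto simp: eigenspace_diag_unbounded_iff)
next
  assume "\<mu> \<in> range g"
  then obtain j where "\<mu> = g j" by auto
  moreover have "ell2_unit j \<noteq> 0"
    using norm_ell2_unit[of j] by (metis norm_zero zero_neq_one)
  ultimately show "is_eigenvalue (diag_unbounded g) \<mu>"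
    by (auto simp: is_eigenvalue_def eigenspace_diag_unbounded_iff intro!: bexI[of _ "ell2_unit j"])
qed

lemma finite_multiplicities_diag_unbounded:
  assumes "\<And>\<mu>. finite {j. g j = \<mu>}"
  shows "finite_multiplicities (diag_unbounded g)"
  unfolding finite_multiplicities_def
proof
  fix \<mu>
  let ?J = "{j. g j = \<mu>}"
  have "x \<in> complex_vector.span (ell2_unit ` ?J)" if "x \<in> eigenspace (diag_unbounded g) \<mu>" for x
  proof -
    have "x = (\<Sum>j\<in>?J. ell2_nth x j *\<^sub>C ell2_unit j)"
      using that assms[of \<mu>]
      by (intro ell2_eqI) (auto simp: eigenspace_diag_unbounded_iff if_distrib cong: if_cong)
    also have "\<dots> \<in> complex_vector.span (ell2_unit ` ?J)"
      by (rule complex_vector.span_sum, rule complex_vector.span_scale,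
          rule complex_vector.span_base, rule imageI)
    finally show ?thesis .
  qed
  then show "\<exists>F. finite F \<and> eigenspace (diag_unbounded g) \<mu> \<subseteq> complex_vector.span F"
    using assms[of \<mu>] by (intro exI[of _ "ell2_unit ` ?J"]) auto
qed

text \<open>The kernel vector \<open>ell2_unit i\<close> puts 0 into the spectrum, and
  \<open>is_resolvent_diag_unbounded\<close> keeps the open left half-plane out of it.\<close>

lemma INF_op_spectrum_diag_unbounded:
  assumes g: "\<And>j. 0 \<le> g j" and "g i = 0"
  shows "(INF z\<in>op_spectrum (diag_unbounded g). ereal (Re z)) = 0"
proof (rule antisym)
  have "0 \<in> op_spectrum (diag_unbounded g)"
  proof -
    have False if "is_resolvent (diag_unbounded g) 0 R" for R
    proof -
      have "the (diag_unbounded g (ell2_unit i)) = 0"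
        by (rule ell2_eqI)
          (simp add: ell2_nth_diag_unbounded ell2_unit_in_dom_diag_unbounded \<open>g i = 0\<close>)
      moreover have "R (the (diag_unbounded g (ell2_unit i)) - 0 *\<^sub>C ell2_unit i) = ell2_unit i"
        using that ell2_unit_in_dom_diag_unbounded[of i g] unfolding is_resolvent_def by blast
      ultimately have "R 0 = ell2_unit i"
        by simp
      moreover have "R 0 = 0"
        using that by (simp add: is_resolvent_def bounded_op_linear linear_0)
      ultimately show False
        using norm_ell2_unit[of i] by simp
    qed
    then show ?thesis by (auto simp: op_spectrum_def)
  qed
  then have "(INF z\<in>op_spectrum (diag_unbounded g). ereal (Re z)) \<le> ereal (Re 0)"
    by (rule INF_lower)
  then show "(INF z\<in>op_spectrum (diag_unbounded g). ereal (Re z)) \<le> 0"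
    by (simp add: zero_ereal_def)
  have "0 \<le> Re z" if "z \<in> op_spectrum (diag_unbounded g)" for z
    using that is_resolvent_diag_unbounded[of g z, OF g] by (force simp: op_spectrum_def)
  then show "0 \<le> (INF z\<in>op_spectrum (diag_unbounded g). ereal (Re z))"
    by (auto intro!: INF_greatest)
qed


section \<open>The diagonal algebra and its rotation\<close>

text \<open>Diagonal operators are written as \<open>pair_op\<close> with vanishing off-diagonal
  part, so that one coordinate formula covers both algebras and their commutators.\<close>

definition diag_algebra :: "(ell2 \<Rightarrow> ell2) set" where
  "diag_algebra = {pair_op c (\<lambda>_. 0) |c. bounded (range c)}"

lemma bounded_op_le_onorm: "bounded_op T \<Longrightarrow> norm (T x) \<le> onorm T * norm x"
  by (simp add: bounded_op_def onorm)

text \<open>The diagonal algebra is maximal abelian, so its bicommutant is computed by applying this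
  equation twice.\<close>

lemma commutant_diag_algebra: "commutant diag_algebra = diag_algebra"
proof (intro equalityI subsetI)
  fix T assume T: "T \<in> commutant diag_algebra"
  then have "bounded_op T" by (simp add: commutant_def)
  define c where "c = (\<lambda>j. ell2_nth (T (ell2_unit j)) j)"
  have "cmod (c j) \<le> onorm T" for j
    using ell2_nth_le_norm[of "T (ell2_unit j)" j] bounded_op_le_onorm[OF \<open>bounded_op T\<close>, of "ell2_unit j"]
    by (simp add: c_def)
  then have c: "bounded (range c)" by (auto simp: bounded_iff)
  have "ell2_nth (T x) j = c j * ell2_nth x j" for x j
  proof -
    \<comment> \<open>Commuting with the projection to coordinate \<open>j\<close> forces coordinate
      \<open>j\<close> of \<open>T x\<close> to depend on that coordinate of \<open>x\<close>
      alone.\<close>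
    define P where "P = pair_op (\<lambda>n. if n = j then 1 else 0) (\<lambda>_. 0)"
    have b: "bounded (range (\<lambda>n. if n = j then 1 else (0 :: complex)))"
      by (auto simp: bounded_iff intro!: exI[of _ 1])
    have "P \<in> diag_algebra"
      using b by (auto simp: P_def diag_algebra_def)
    then have "T \<circ> P = P \<circ> T"
      using T by (simp add: commutant_def)
    then have "T (P x) = P (T x)"
      by (simp add: fun_eq_iff)
    moreover have nth_P: "ell2_nth (P y) n = (if n = j then ell2_nth y n else 0)" for y n
      by (simp add: P_def ell2_nth_pair_op[OF b bounded_range_const])
    ultimately have "ell2_nth (T x) j = ell2_nth (T (P x)) j"
      by simp
    also have "P x = ell2_nth x j *\<^sub>C ell2_unit j"
      by (rule ell2_eqI) (simp add: nth_P)
    finally show ?thesis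
      by (simp add: bounded_op_scaleC \<open>bounded_op T\<close> c_def)
  qed
  then have "T = pair_op c (\<lambda>_. 0)"
    by (intro ext ell2_eqI) (simp add: ell2_nth_pair_op c bounded_range_const)
  then show "T \<in> diag_algebra"
    using c by (auto simp: diag_algebra_def)
next
  fix T assume "T \<in> diag_algebra"
  then obtain c where c: "bounded (range c)" and T: "T = pair_op c (\<lambda>_. 0)"
    by (auto simp: diag_algebra_def)
  have "T \<circ> A = A \<circ> T" if A_in: "A \<in> diag_algebra" for A
  proof -
    obtain c' where c': "bounded (range c')" and A: "A = pair_op c' (\<lambda>_. 0)"
      using A_in by (auto simp: diag_algebra_def)
    show ?thesis
      by (rule ext, rule ell2_eqI) (simp add: T A ell2_nth_pair_op c c' bounded_range_const)
  qed
  then show "T \<in> commutant diag_algebra"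
    using c by (simp add: commutant_def T bounded_op_pair_op bounded_range_const)
qed

lemma von_neumann_diag_algebra: "von_neumann_algebra diag_algebra"
  unfolding von_neumann_algebra_def commutant_diag_algebra
proof (intro conjI ballI)
  show "diag_algebra \<subseteq> Collect bounded_op"
    by (auto simp: diag_algebra_def bounded_op_pair_op bounded_range_const)
  fix A assume "A \<in> diag_algebra"
  then obtain c where c: "bounded (range c)" and A: "A = pair_op c (\<lambda>_. 0)"
    by (auto simp: diag_algebra_def)
  have "is_adjoint A (pair_op (\<lambda>j. cnj (c j)) (\<lambda>_. 0))"
    using is_adjoint_pair_op[OF c bounded_range_const[of 0]] by (simp add: A)
  moreover have "pair_op (\<lambda>j. cnj (c j)) (\<lambda>_. 0) \<in> diag_algebra"
    using bounded_range_cnj[OF c] by (auto simp: diag_algebra_def)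
  ultimately show "\<exists>B\<in>diag_algebra. is_adjoint A B" by blast
qed simp

text \<open>Used with an involution \<open>U\<close>, for which this is conjugation by
  \<open>U\<close> and its inverse.\<close>

definition conjugate_by :: "('a \<Rightarrow> 'a) \<Rightarrow> ('a \<Rightarrow> 'a) \<Rightarrow> 'a \<Rightarrow> 'a" where
  "conjugate_by U T = U \<circ> T \<circ> U"

text \<open>One inclusion is direct for every set; applied to the conjugated set it gives the other,
  because conjugation is itself an involution.\<close>

lemma commutant_conjugate:
  assumes U: "bounded_op U" "U \<circ> U = id"
  shows "commutant (conjugate_by U ` M) = conjugate_by U ` commutant M"
proof -
  have UU: "U (U x) = x" for x
    using U(2) by (metis comp_apply id_apply)
  have conj_conj: "conjugate_by U (conjugate_by U T) = T" for T
    by (simp add: conjugate_by_def fun_eq_iff UU)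
  have comp: "conjugate_by U S \<circ> conjugate_by U T = conjugate_by U (S \<circ> T)" for S T
    by (simp add: conjugate_by_def fun_eq_iff UU)
  have sub: "conjugate_by U ` commutant M \<subseteq> commutant (conjugate_by U ` M)" for M
    by (auto simp: commutant_def comp) (simp add: conjugate_by_def bounded_op_compose U(1))
  have image_image: "conjugate_by U ` conjugate_by U ` S = S" for S
    by (simp add: image_image conj_conj)
  have "commutant (conjugate_by U ` M)
      = conjugate_by U ` conjugate_by U ` commutant (conjugate_by U ` M)"
    by (simp only: image_image)
  also have "\<dots> \<subseteq> conjugate_by U ` commutant (conjugate_by U ` conjugate_by U ` M)"
    by (intro image_mono sub)
  also have "\<dots> = conjugate_by U ` commutant M"
    by (simp only: image_image)
  finally show ?thesis
    using sub by blast
qed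

lemma von_neumann_algebra_conjugate:
  assumes M: "von_neumann_algebra M" and U: "bounded_selfadjoint U" "U \<circ> U = id"
  shows "von_neumann_algebra (conjugate_by U ` M)"
  unfolding von_neumann_algebra_def
proof (intro conjI ballI)
  have bU: "bounded_op U" using U by (simp add: bounded_selfadjoint_def)
  have UM: "M \<subseteq> Collect bounded_op" "commutant (commutant M) = M"
    using M by (auto simp: von_neumann_algebra_def)
  show "conjugate_by U ` M \<subseteq> Collect bounded_op"
    using UM bU by (auto simp: conjugate_by_def intro!: bounded_op_compose)
  show "commutant (commutant (conjugate_by U ` M)) = conjugate_by U ` M"
    by (simp only: commutant_conjugate[OF bU U(2)] UM(2))
  fix A assume "A \<in> conjugate_by U ` M"
  then obtain T where T: "T \<in> M" "A = conjugate_by U T" by auto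
  then obtain S where S: "S \<in> M" "is_adjoint T S"
    using M by (auto simp: von_neumann_algebra_def)
  then have "is_adjoint A (conjugate_by U S)"
    using U by (simp add: T is_adjoint_def conjugate_by_def bounded_selfadjoint_def)
  then show "\<exists>B\<in>conjugate_by U ` M. is_adjoint A B"
    using S by blast
qed


section \<open>The commutator bound\<close>

lemma norm_commutator_le:
  assumes "bounded_op a" "onorm a \<le> 1" "bounded_op b" "onorm b \<le> 1"
  shows "norm (commutator a b v) \<le> 2 * norm v"
proof -
  have contraction: "norm (T x) \<le> norm x" if "bounded_op T" "onorm T \<le> 1" for T and x :: 'a
    using bounded_op_le_onorm[OF that(1), of x] mult_right_mono[OF that(2), of "norm x"] by simp
  have "norm (commutator a b v) \<le> norm (a (b v)) + norm (b (a v))"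
    unfolding commutator_def by (rule norm_triangle_ineq4)
  also have "\<dots> \<le> norm v + norm v"
    by (intro add_mono) (meson assms contraction order_trans)+
  finally show ?thesis by simp
qed

text \<open>The Jacobi identity, with the two factors \<open>-\<i>\<close> multiplying to
  \<open>-1\<close>: the commutator of two inner derivations is again inner, implemented by
  \<open>[a, b]\<close>.\<close>

lemma derivation_commutator_eq:
  assumes a: "bounded_op a" and b: "bounded_op b" and x: "bounded_op x"
  shows "derivation_commutator a b x v = x (commutator a b v) - commutator a b (x v)"
proof -
  define k where "k = - \<i>"
  have m: "k *\<^sub>C k *\<^sub>C u = - u" for u :: 'a
    using scaleC_of_real[of "-1" u] by (simp add: scaleC_scaleC k_def)
  note lin = bounded_op_linear[OF a] bounded_op_linear[OF b] bounded_op_linear[OF x]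
  have 1: "inner_derivation S (inner_derivation T x) v = - (S (T (x v)) - S (x (T v)) - T (x (S v)) + x (T (S v)))"
    if "bounded_op S" for S T
  proof -
    have "inner_derivation S (inner_derivation T x) v
        = k *\<^sub>C k *\<^sub>C (S (commutator T x v) - commutator T x (S v))"
      by (simp only: inner_derivation_def k_def[symmetric] commutator_def[of S] bounded_op_scaleC[OF that]
          complex_vector.scale_right_diff_distrib)
    then show ?thesis
      by (simp only: m) (simp add: commutator_def linear_diff[OF bounded_op_linear[OF that]])
  qed
  show ?thesis
    by (simp only: derivation_commutator_def 1[OF a] 1[OF b])
      (simp add: commutator_def linear_diff[OF lin(3)])
qed

text \<open>The norm only tests tuples in the unit ball; homogeneity extends the bound to all
  \<open>v\<close>. \<open>L2_set\<close> makes Minkowski's inequality available.\<close>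

lemma op_matrix_norm_leD:
  assumes "op_matrix_norm n X \<le> ereal 1" and X: "\<And>i j. i < n \<Longrightarrow> j < n \<Longrightarrow> bounded_op (X i j)"
  shows "L2_set (\<lambda>i. norm (\<Sum>j<n. X i j (v j))) {..<n} \<le> L2_set (\<lambda>j. norm (v j)) {..<n}"
proof -
  have unit: "L2_set (\<lambda>i. norm (\<Sum>j<n. X i j (w j))) {..<n} \<le> 1"
    if "L2_set (\<lambda>j. norm (w j)) {..<n} \<le> 1" for w
  proof -
    have "ereal (sqrt (\<Sum>i<n. (norm (\<Sum>j<n. X i j (w j)))\<^sup>2)) \<le> op_matrix_norm n X"
      unfolding op_matrix_norm_def
      by (rule SUP_upper) (use that in \<open>simp add: L2_set_def\<close>)
    from order_trans[OF this assms(1)] show ?thesis by (simp add: L2_set_def)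
  qed
  define l where "l = L2_set (\<lambda>j. norm (v j)) {..<n}"
  show ?thesis
  proof (cases "l = 0")
    case True
    then have "v j = 0" if "j < n" for j
      using that by (simp add: l_def L2_set_eq_0_iff)
    then have "(\<Sum>j<n. X i j (v j)) = 0" if "i < n" for i
      using that by (intro sum.neutral) (auto simp: linear_0 bounded_op_linear X)
    then show ?thesis
      using True by (simp add: l_def L2_set_def)
  next
    case False
    moreover have "0 \<le> l" by (simp add: l_def)
    ultimately have "l > 0" by simp
    have scale: "L2_set (\<lambda>i. norm ((1 / l) *\<^sub>R f i)) {..<n} = (1 / l) * L2_set (\<lambda>i. norm (f i)) {..<n}"
      for f :: "nat \<Rightarrow> 'a"
      using \<open>l > 0\<close> L2_set_right_distrib[of "1 / l" "\<lambda>i. norm (f i)" "{..<n}"] by simp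
    have "(\<Sum>j<n. X i j ((1 / l) *\<^sub>R v j)) = (1 / l) *\<^sub>R (\<Sum>j<n. X i j (v j))" if "i < n" for i
      using that unfolding scaleR_sum_right
      by (intro sum.cong refl linear_scale bounded_op_linear X) auto
    then have "L2_set (\<lambda>i. norm (\<Sum>j<n. X i j ((1 / l) *\<^sub>R v j))) {..<n}
        = L2_set (\<lambda>i. norm ((1 / l) *\<^sub>R (\<Sum>j<n. X i j (v j)))) {..<n}"
      by (intro L2_set_cong) auto
    moreover have "L2_set (\<lambda>i. norm (\<Sum>j<n. X i j ((1 / l) *\<^sub>R v j))) {..<n} \<le> 1"
      by (rule unit) (use \<open>l > 0\<close> in \<open>simp only: scale\<close>, simp add: l_def)
    ultimately show ?thesis
      using \<open>l > 0\<close> by (simp only: scale) (simp add: l_def field_simps)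
  qed
qed

text \<open>On matrices the map is still a commutator, now with \<open>h = [a, b]\<close> acting in
  every component. That amplification has norm at most 2, so each of the two terms contributes at
  most 2, for every matrix size \<open>n\<close>.\<close>

lemma cb_norm_derivation_commutator_le:
  assumes a: "bounded_op a" "onorm a \<le> 1" and b: "bounded_op b" "onorm b \<le> 1"
  shows "cb_norm (derivation_commutator a b) \<le> 4"
  unfolding cb_norm_def
proof (intro SUP_least, clarify)
  fix n :: nat and X :: "nat \<Rightarrow> nat \<Rightarrow> 'a \<Rightarrow> 'a"
  assume X: "\<forall>i<n. \<forall>j<n. bounded_op (X i j)" "op_matrix_norm n X \<le> 1"
  let ?h = "commutator a b"
  have "bounded_op ?h"
    unfolding commutator_def bounded_op_def
    using a b by (auto simp: bounded_op_def complex_vector.scale_right_diff_distrib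
        intro!: bounded_linear_sub bounded_linear_compose[of a] bounded_linear_compose[of b])
  then have lin: "linear ?h" by (simp add: bounded_op_linear)
  have X_le: "L2_set (\<lambda>i. norm (\<Sum>j<n. X i j (v j))) {..<n} \<le> L2_set (\<lambda>j. norm (v j)) {..<n}" for v
    by (rule op_matrix_norm_leD) (use X in \<open>auto simp: one_ereal_def\<close>)
  have h_le: "L2_set (\<lambda>j. norm (?h (f j))) {..<n} \<le> 2 * L2_set (\<lambda>j. norm (f j)) {..<n}" for f
  proof -
    have "L2_set (\<lambda>j. norm (?h (f j))) {..<n} \<le> L2_set (\<lambda>j. 2 * norm (f j)) {..<n}"
      by (intro L2_set_mono norm_commutator_le assms) auto
    then show ?thesis by (simp add: L2_set_right_distrib)
  qed
  show "op_matrix_norm n (\<lambda>i j. derivation_commutator a b (X i j)) \<le> 4"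
    unfolding op_matrix_norm_def
  proof (intro SUP_least, clarify)
    fix v :: "nat \<Rightarrow> 'a" assume "sqrt (\<Sum>j<n. (norm (v j))\<^sup>2) \<le> 1"
    then have v: "L2_set (\<lambda>j. norm (v j)) {..<n} \<le> 1" by (simp add: L2_set_def)
    let ?A = "\<lambda>i. \<Sum>j<n. X i j (?h (v j))" and ?B = "\<lambda>i. ?h (\<Sum>j<n. X i j (v j))"
    have "(\<Sum>j<n. derivation_commutator a b (X i j) (v j)) = ?A i - ?B i" if "i < n" for i
      using X that
      by (simp add: derivation_commutator_eq a b linear_sum[OF lin] sum_subtractf)
    then have "L2_set (\<lambda>i. norm (\<Sum>j<n. derivation_commutator a b (X i j) (v j))) {..<n}
        = L2_set (\<lambda>i. norm (?A i - ?B i)) {..<n}"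
      by (intro L2_set_cong) auto
    also have "\<dots> \<le> L2_set (\<lambda>i. norm (?A i) + norm (?B i)) {..<n}"
      by (intro L2_set_mono norm_triangle_ineq4) auto
    also have "\<dots> \<le> L2_set (\<lambda>i. norm (?A i)) {..<n} + L2_set (\<lambda>i. norm (?B i)) {..<n}"
      by (rule L2_set_triangle_ineq)
    also have "\<dots> \<le> 2 + 2"
    proof (intro add_mono)
      show "L2_set (\<lambda>i. norm (?A i)) {..<n} \<le> 2"
        using X_le[of "\<lambda>j. ?h (v j)"] h_le[of v] v by linarith
      show "L2_set (\<lambda>i. norm (?B i)) {..<n} \<le> 2"
        using X_le[of v] h_le[of "\<lambda>i. \<Sum>j<n. X i j (v j)"] v by linarith
    qed
    finally show "ereal (sqrt (\<Sum>i<n. (norm (\<Sum>j<n. derivation_commutator a b (X i j) (v j)))\<^sup>2)) \<le> 4"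
      by (simp add: L2_set_def)
  qed
qed

lemma Gamma_MN_le: "Gamma_MN M N \<le> 4"
  unfolding Gamma_MN_def
  by (intro SUP_least, clarify, rule cb_norm_derivation_commutator_le)
    (auto simp: sa_unit_ball_def bounded_selfadjoint_def)

text \<open>Matrices of size 1 already give the lower bound.\<close>

lemma norm_derivation_commutator_le_cb_norm:
  assumes "bounded_op x" "onorm x \<le> 1" "norm v \<le> 1"
  shows "ereal (norm (derivation_commutator a b x v)) \<le> cb_norm (derivation_commutator a b)"
proof -
  have "op_matrix_norm 1 (\<lambda>_ _. x) \<le> 1"
    unfolding op_matrix_norm_def
  proof (intro SUP_least, clarify)
    fix w :: "nat \<Rightarrow> 'a" assume "sqrt (\<Sum>j<1. (norm (w j))\<^sup>2) \<le> 1"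
    then have "norm (w 0) \<le> 1" by simp
    then have "norm (x (w 0)) \<le> 1"
      using bounded_op_le_onorm[OF assms(1), of "w 0"] mult_mono[OF assms(2), of "norm (w 0)" 1] by simp
    then show "ereal (sqrt (\<Sum>i<1::nat. (norm (\<Sum>j<1. x (w j)))\<^sup>2)) \<le> 1" by simp
  qed
  then have "op_matrix_norm 1 (\<lambda>_ _. derivation_commutator a b x) \<le> cb_norm (derivation_commutator a b)"
    unfolding cb_norm_def
    by (intro SUP_upper2[of "(1, \<lambda>_ _. x)"]) (use assms in auto)
  moreover have "ereal (sqrt (\<Sum>i<1::nat. (norm (\<Sum>j<1::nat. derivation_commutator a b x v))\<^sup>2))
      \<le> op_matrix_norm 1 (\<lambda>_ _. derivation_commutator a b x)"
    unfolding op_matrix_norm_def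
    by (rule SUP_upper2[of "\<lambda>_. v"]) (use assms in auto)
  ultimately show ?thesis
    by (simp add: order_trans)
qed


section \<open>Energy-constrained states\<close>

text \<open>The diagonal of a state is a probability distribution on the coordinates. Only this
  distribution enters the estimates, since the squared commutators and the energy operator are
  diagonal.\<close>

lemma density_operator_diagonal:
  assumes "density_operator \<rho>"
  shows "ell2_nth (\<rho> (ell2_unit j)) j = complex_of_real (Re (ell2_nth (\<rho> (ell2_unit j)) j))"
    and "0 \<le> Re (ell2_nth (\<rho> (ell2_unit j)) j)"
    and "(\<lambda>j. Re (ell2_nth (\<rho> (ell2_unit j)) j)) sums 1"
proof -
  have "cinner (\<rho> (ell2_unit j)) (ell2_unit j) = cinner (ell2_unit j) (\<rho> (ell2_unit j))"
    using assms unfolding density_operator_def bounded_selfadjoint_def is_adjoint_def by blast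
  then show "ell2_nth (\<rho> (ell2_unit j)) j = complex_of_real (Re (ell2_nth (\<rho> (ell2_unit j)) j))"
    by (simp add: complex_eq_iff)
  have "0 \<le> Re (cinner (ell2_unit j) (\<rho> (ell2_unit j)))"
    using assms unfolding density_operator_def by blast
  then show "0 \<le> Re (ell2_nth (\<rho> (ell2_unit j)) j)"
    by simp
  have "has_trace \<rho> 1" using assms by (simp add: density_operator_def)
  from has_sum_Re[OF has_trace_imp_has_sum_diagonal[OF this]]
  show "(\<lambda>j. Re (ell2_nth (\<rho> (ell2_unit j)) j)) sums 1"
    by (intro has_sum_imp_sums) simp
qed

text \<open>The trace is a mean under the diagonal of \<open>\<rho>\<close>. As \<open>T\<close>
  acts first, its values on basis vectors are all that matters.\<close>

lemma has_trace_compose_diagonal: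
  assumes \<rho>: "density_operator \<rho>" and tr: "has_trace (\<rho> \<circ> T) (complex_of_real t)"
    and T: "\<And>j. T (ell2_unit j) = c j *\<^sub>C ell2_unit j"
  shows "(\<lambda>j. Re (c j) * Re (ell2_nth (\<rho> (ell2_unit j)) j)) sums t"
proof -
  have "bounded_op \<rho>"
    using \<rho> by (simp add: density_operator_def bounded_selfadjoint_def)
  then have "ell2_nth ((\<rho> \<circ> T) (ell2_unit j)) j = c j * ell2_nth (\<rho> (ell2_unit j)) j" for j
    by (simp add: T bounded_op_scaleC)
  moreover have "Im (ell2_nth (\<rho> (ell2_unit j)) j) = 0" for j
    using arg_cong[OF density_operator_diagonal(1)[OF \<rho>, of j], of Im] by simp
  ultimately have "Re (ell2_nth ((\<rho> \<circ> T) (ell2_unit j)) j) = Re (c j) * Re (ell2_nth (\<rho> (ell2_unit j)) j)" for j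
    by simp
  with has_sum_Re[OF has_trace_imp_has_sum_diagonal[OF tr]] show ?thesis
    by (intro has_sum_imp_sums) simp
qed

text \<open>Markov's inequality for the diagonal distribution and the function \<open>g\<close>,
  proved for the bounded approximants and passed to the limit.\<close>

lemma energy_tail_le:
  assumes \<rho>: "density_operator \<rho>" and en: "has_energy (diag_unbounded g) \<rho> w"
    and g: "\<And>j. 0 \<le> g j" and C: "0 < C" "\<And>j. m \<le> j \<Longrightarrow> C \<le> g j"
  shows "1 - (\<Sum>j<m. Re (ell2_nth (\<rho> (ell2_unit j)) j)) \<le> w / C"
proof -
  define d where "d = (\<lambda>j. Re (ell2_nth (\<rho> (ell2_unit j)) j))"
  define tail where "tail = 1 - (\<Sum>j<m. d j)"
  have d_nonneg: "0 \<le> d j" for j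
    using density_operator_diagonal(2)[OF \<rho>] by (simp add: d_def)
  have "(\<lambda>j. d j - (if j \<in> {..<m} then d j else 0)) sums tail"
    unfolding tail_def using density_operator_diagonal(3)[OF \<rho>]
    by (intro sums_diff sums_If_finite_set) (simp_all add: d_def)
  moreover have "(\<lambda>j. d j - (if j \<in> {..<m} then d j else 0)) = (\<lambda>j. if m \<le> j then d j else 0)"
    by auto
  ultimately have tail_sums: "(\<lambda>j. if m \<le> j then d j else 0) sums tail" by simp
  obtain s where s: "\<And>t. t > 0 \<Longrightarrow>
      has_trace (\<rho> \<circ> bounded_approximant (diag_unbounded g) t) (complex_of_real (s t))"
    and lim: "(s \<longlongrightarrow> w) at_top"
    using en by (auto simp: has_energy_def)
  \<comment> \<open>The factor is \<open>t * C / (C + t)\<close>, the approximant at eigenvalue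
    \<open>C\<close>, in a form whose limit \<open>C\<close> for large \<open>t\<close> is visible.
    It bounds the approximant on the tail because \<open>x / (x + t)\<close> increases with
    \<open>x\<close>.\<close>
  have "C / (C / t + 1) * tail \<le> s t" if "t > 0" for t
  proof -
    have "(\<lambda>j. C / (C / t + 1) * (if m \<le> j then d j else 0)) sums (C / (C / t + 1) * tail)"
      by (intro sums_mult tail_sums)
    moreover have "(\<lambda>j. t * (g j / (g j + t)) * d j) sums s t"
      using has_trace_compose_diagonal[OF \<rho> s[OF that] bounded_approximant_diag_unbounded[OF g that]]
      by (simp add: d_def)
    moreover have "C / (C / t + 1) * (if m \<le> j then d j else 0) \<le> t * (g j / (g j + t)) * d j" for j
    proof (cases "m \<le> j")
      case True
      have "C / (C / t + 1) = t * (C / (C + t))"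
        using that C by (simp add: field_simps)
      also have "C / (C + t) \<le> g j / (g j + t)"
        using C(1) C(2)[OF True] that by (simp add: frac_le_eq divide_le_0_iff algebra_simps)
      finally have "C / (C / t + 1) \<le> t * (g j / (g j + t))"
        using that by simp
      from mult_right_mono[OF this d_nonneg[of j]] show ?thesis
        using True by simp
    qed (use g[of j] that d_nonneg[of j] in simp)
    ultimately show ?thesis
      by (rule sums_le[rotated])
  qed
  then have "\<forall>\<^sub>F t in at_top. C / (C / t + 1) * tail \<le> s t"
    using eventually_gt_at_top[of 0] by (rule eventually_mono[rotated])
  moreover have "((\<lambda>t. C / t) \<longlongrightarrow> 0) at_top"
    by (auto intro!: tendsto_divide_0[OF tendsto_const] filterlim_at_top_imp_at_infinity filterlim_ident)
  then have "((\<lambda>t. C / (C / t + 1) * tail) \<longlongrightarrow> C / (0 + 1) * tail) at_top"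
    by (intro tendsto_intros; simp)
  ultimately have "C * tail \<le> w"
    using tendsto_le[OF _ lim] by fastforce
  then show ?thesis
    using C(1) by (simp add: tail_def d_def field_simps)
qed

text \<open>The energy bound leaves weight at most \<open>r / 2\<close> beyond \<open>m\<close>, so
  at least \<open>1 - r / 2\<close> sits where the second moment is reduced. Subtracting the squared
  mean only lowers the variance.\<close>

lemma gamma_GE_le:
  assumes h: "\<And>j. h (h (ell2_unit j)) = c j *\<^sub>C ell2_unit j"
    and c: "\<And>j. cmod (c j) \<le> 4" "\<And>j. j < m \<Longrightarrow> cmod (c j) \<le> 4 * (1 - r)"
    and r: "0 < r" "r < 1" and g: "\<And>j. 0 \<le> g j"
    and "0 < E" "\<And>j. m \<le> j \<Longrightarrow> 2 * E / r \<le> g j"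
  shows "gamma_GE (diag_unbounded g) E h \<le> ereal (4 - r)"
proof -
  have "sqrt (m2 - m1\<^sup>2) \<le> 2 - r / 2"
    if \<rho>: "density_operator \<rho>" and w: "w \<le> E" "has_energy (diag_unbounded g) \<rho> w"
      and m2: "has_trace (\<rho> \<circ> (h \<circ> h)) (complex_of_real m2)" for \<rho> m2 m1 w
  proof -
    define d where "d = (\<lambda>j. Re (ell2_nth (\<rho> (ell2_unit j)) j))"
    have d_nonneg: "0 \<le> d j" for j
      using density_operator_diagonal(2)[OF \<rho>] by (simp add: d_def)
    have "1 - (\<Sum>j<m. d j) \<le> w / (2 * E / r)"
      unfolding d_def by (rule energy_tail_le[OF \<rho> w(2) g]) (use assms in auto)
    also have "\<dots> \<le> E / (2 * E / r)"
      using w r \<open>0 < E\<close> by (intro divide_right_mono) auto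
    finally have tail: "1 - (\<Sum>j<m. d j) \<le> r / 2"
      using \<open>0 < E\<close> by simp
    have "(\<lambda>j. Re (c j) * d j) sums m2"
      using has_trace_compose_diagonal[OF \<rho> m2, of c] h by (simp add: d_def)
    \<comment> \<open>The majorant of \<open>Re (c j) * d j\<close>: coefficient
      \<open>4 * (1 - r)\<close> below \<open>m\<close> and 4 from \<open>m\<close> on.\<close>
    moreover have "(\<lambda>j. 4 * d j - 4 * r * (if j \<in> {..<m} then d j else 0)) sums (4 * 1 - 4 * r * (\<Sum>j<m. d j))"
      using density_operator_diagonal(3)[OF \<rho>]
      by (intro sums_diff sums_mult sums_If_finite_set) (simp_all add: d_def)
    moreover have "Re (c j) * d j \<le> 4 * d j - 4 * r * (if j \<in> {..<m} then d j else 0)" for j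
    proof -
      have "Re (c j) * d j \<le> cmod (c j) * d j"
        by (intro mult_right_mono complex_Re_le_cmod d_nonneg)
      also have "\<dots> \<le> 4 * d j - 4 * r * (if j \<in> {..<m} then d j else 0)"
        using mult_right_mono[OF c(1) d_nonneg[of j]] mult_right_mono[OF c(2) d_nonneg[of j]]
        by (auto simp: algebra_simps)
      finally show ?thesis .
    qed
    ultimately have "m2 \<le> 4 * 1 - 4 * r * (\<Sum>j<m. d j)"
      by (rule sums_le[rotated])
    also have "\<dots> \<le> 4 - 4 * r * (1 - r / 2)"
      using tail r by (simp add: mult_left_mono)
    \<comment> \<open>The gap is \<open>2 * r * (1 - r)\<close>, non-negative since
      \<open>r < 1\<close>.\<close>
    also have "\<dots> \<le> 4 - 2 * r"
      using r by (simp add: algebra_simps power2_eq_square)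
    finally have "m2 \<le> 4 - 2 * r" .
    moreover have "(2 - r / 2)\<^sup>2 = 4 - 2 * r + (r / 2)\<^sup>2"
      by (simp add: power2_eq_square field_simps)
    ultimately have "m2 - m1\<^sup>2 \<le> (2 - r / 2)\<^sup>2"
      using zero_le_power2[of m1] zero_le_power2[of "r / 2"] by linarith
    then have "sqrt (m2 - m1\<^sup>2) \<le> sqrt ((2 - r / 2)\<^sup>2)"
      by (rule real_sqrt_le_mono)
    then show ?thesis
      using r by simp
  qed
  then have "gamma_GE (diag_unbounded g) E h \<le> 2 * ereal (2 - r / 2)"
    unfolding gamma_GE_def by (intro ereal_mult_left_mono SUP_least) auto
  then show ?thesis
    by (simp add: algebra_simps)
qed


section \<open>Block rotations\<close>

text \<open>On a block with even index \<open>j\<close> the operator \<open>U\<close> has rows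
  \<open>(p j, q j)\<close> and \<open>(q j, - p j)\<close>: a real symmetric reflection, hence a
  self-adjoint involution. The product \<open>2 * p j * q j\<close> is, up to sign, the sine of the
  angle between the two Pauli directions.\<close>

locale pair_rotation =
  fixes p q :: "nat \<Rightarrow> real"
  assumes p_partner: "p (partner j) = - p j"
    and q_partner: "q (partner j) = q j"
    and pq_unit: "(p j)\<^sup>2 + (q j)\<^sup>2 = 1"
begin

definition cp :: "nat \<Rightarrow> complex" where "cp j = complex_of_real (p j)"
definition cq :: "nat \<Rightarrow> complex" where "cq j = complex_of_real (q j)"

definition U :: "ell2 \<Rightarrow> ell2" where "U = pair_op cp cq"

definition rotated_algebra :: "(ell2 \<Rightarrow> ell2) set" where
  "rotated_algebra = conjugate_by U ` diag_algebra"

lemma bounded_cp [simp]: "bounded (range cp)"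
proof -
  have "cmod (cp j) \<le> 1" for j
  proof -
    have "(p j)\<^sup>2 \<le> 1"
      using pq_unit[of j] zero_le_power2[of "q j"] by linarith
    then show ?thesis by (simp add: cp_def abs_square_le_1)
  qed
  then show ?thesis by (auto simp: bounded_iff)
qed

lemma bounded_cq [simp]: "bounded (range cq)"
proof -
  have "cmod (cq j) \<le> 1" for j
  proof -
    have "(q j)\<^sup>2 \<le> 1"
      using pq_unit[of j] zero_le_power2[of "p j"] by linarith
    then show ?thesis by (simp add: cq_def abs_square_le_1)
  qed
  then show ?thesis by (auto simp: bounded_iff)
qed

lemma cp_partner [simp]: "cp (partner j) = - cp j"
  by (simp add: cp_def p_partner)

lemma cq_partner [simp]: "cq (partner j) = cq j"
  by (simp add: cq_def q_partner)

lemma cpq_unit: "cp j * cp j + cq j * cq j = 1"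
proof -
  have "complex_of_real ((p j)\<^sup>2 + (q j)\<^sup>2) = 1"
    by (simp only: pq_unit of_real_1)
  then show ?thesis by (simp add: cp_def cq_def power2_eq_square)
qed

lemma U_U: "U (U x) = x"
proof (rule ell2_eqI)
  fix n
  have "ell2_nth (U (U x)) n = (cp n * cp n + cq n * cq n) * ell2_nth x n"
    by (simp add: U_def ell2_nth_pair_op algebra_simps)
  then show "ell2_nth (U (U x)) n = ell2_nth x n"
    by (simp add: cpq_unit)
qed

lemma bounded_selfadjoint_U: "bounded_selfadjoint U"
proof -
  have "is_adjoint U (pair_op (\<lambda>j. cnj (cp j)) (\<lambda>j. cnj (cq (partner j))))"
    unfolding U_def by (rule is_adjoint_pair_op) auto
  moreover have "pair_op (\<lambda>j. cnj (cp j)) (\<lambda>j. cnj (cq (partner j))) = U"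
    by (simp add: U_def cp_def[abs_def] cq_def[abs_def] q_partner)
  ultimately show ?thesis
    by (simp add: bounded_selfadjoint_def U_def bounded_op_pair_op)
qed

lemma norm_U [simp]: "norm (U x) = norm x"
proof -
  have "cinner (U x) (U x) = cinner x x"
    using bounded_selfadjoint_U by (simp add: bounded_selfadjoint_def is_adjoint_def U_U)
  then have "(norm (U x))\<^sup>2 = (norm x)\<^sup>2"
    unfolding cinner_self by (simp only: of_real_eq_iff)
  then show ?thesis by simp
qed

lemma von_neumann_rotated_algebra: "von_neumann_algebra rotated_algebra"
  unfolding rotated_algebra_def
  by (rule von_neumann_algebra_conjugate[OF von_neumann_diag_algebra bounded_selfadjoint_U])
    (simp add: fun_eq_iff U_U)

text \<open>On each block both operators are a scalar plus half a coefficient difference times a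
  reflection. Scalars commute with everything, so only the differences survive, and a commutator
  with the diagonal reflection is off-diagonal.\<close>

lemma commutator_diag_rotated:
  assumes "bounded (range \<alpha>)" "bounded (range \<beta>)"
  shows "commutator (pair_op \<alpha> (\<lambda>_. 0)) (conjugate_by U (pair_op \<beta> (\<lambda>_. 0))) =
    pair_op (\<lambda>_. 0) (\<lambda>j. cp j * cq j * (\<alpha> j - \<alpha> (partner j)) * (\<beta> j - \<beta> (partner j)))"
proof (rule ext, rule ell2_eqI)
  fix v j
  have b: "bounded (range (\<lambda>j. cp j * cq j * (\<alpha> j - \<alpha> (partner j)) * (\<beta> j - \<beta> (partner j))))"
    by (intro bounded_range_intros assms bounded_cp bounded_cq)
  show "ell2_nth (commutator (pair_op \<alpha> (\<lambda>_. 0)) (conjugate_by U (pair_op \<beta> (\<lambda>_. 0))) v) j =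
      ell2_nth (pair_op (\<lambda>_. 0) (\<lambda>j. cp j * cq j * (\<alpha> j - \<alpha> (partner j)) * (\<beta> j - \<beta> (partner j))) v) j"
    by (simp add: ell2_nth_pair_op[OF bounded_range_const b])
      (simp add: commutator_def conjugate_by_def U_def ell2_nth_pair_op assms bounded_range_const algebra_simps)
qed

lemma diag_coeff_le_onorm:
  assumes "bounded (range \<alpha>)"
  shows "cmod (\<alpha> j) \<le> onorm (pair_op \<alpha> (\<lambda>_. 0))"
  using ell2_nth_le_norm[of "pair_op \<alpha> (\<lambda>_. 0) (ell2_unit j)" j]
    bounded_op_le_onorm[OF bounded_op_pair_op[OF assms bounded_range_const[of 0]], of "ell2_unit j"]
  by (simp add: ell2_nth_pair_op assms bounded_range_const)

text \<open>The unit vector \<open>U (ell2_unit j)\<close> is an eigenvector of the rotated operator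
  with eigenvalue \<open>\<beta> j\<close>.\<close>

lemma rotated_coeff_le_onorm:
  assumes "bounded (range \<beta>)"
  shows "cmod (\<beta> j) \<le> onorm (conjugate_by U (pair_op \<beta> (\<lambda>_. 0)))"
proof -
  let ?b = "conjugate_by U (pair_op \<beta> (\<lambda>_. 0))"
  have "bounded_op ?b"
    using bounded_selfadjoint_U assms unfolding conjugate_by_def bounded_selfadjoint_def
    by (intro bounded_op_compose bounded_op_pair_op bounded_range_const) auto
  have "cmod (\<beta> j) \<le> norm (pair_op \<beta> (\<lambda>_. 0) (ell2_unit j))"
    using ell2_nth_le_norm[of "pair_op \<beta> (\<lambda>_. 0) (ell2_unit j)" j]
    by (simp add: ell2_nth_pair_op assms bounded_range_const)
  also have "\<dots> = norm (?b (U (ell2_unit j)))"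
    by (simp add: conjugate_by_def U_U)
  also have "\<dots> \<le> onorm ?b"
    using bounded_op_le_onorm[OF \<open>bounded_op ?b\<close>, of "U (ell2_unit j)"] by simp
  finally show ?thesis .
qed

text \<open>The off-diagonal coefficient \<open>\<kappa>\<close> changes sign under
  \<open>partner\<close>, so \<open>-\<i> [a, b]\<close> squares to the diagonal operator with
  entries the squares of \<open>\<kappa>\<close>, and \<open>gamma_GE_le\<close> applies.\<close>

lemma Gamma_GE_rotated_le:
  assumes m: "\<And>j. j < m \<Longrightarrow> 4 * (p j * q j)\<^sup>2 \<le> 1 - r"
    and r: "0 < r" "r < 1" and g: "\<And>j. 0 \<le> g j"
    and E: "0 < E" "\<And>j. m \<le> j \<Longrightarrow> 2 * E / r \<le> g j"
  shows "Gamma_GE (diag_unbounded g) E diag_algebra rotated_algebra \<le> ereal (4 - r)"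
  unfolding Gamma_GE_def
proof (intro SUP_least, clarify)
  fix a b assume a_in: "a \<in> sa_unit_ball diag_algebra" and b_in: "b \<in> sa_unit_ball rotated_algebra"
  obtain \<alpha> where \<alpha>: "bounded (range \<alpha>)" and a: "a = pair_op \<alpha> (\<lambda>_. 0)"
    using a_in by (auto simp: sa_unit_ball_def diag_algebra_def)
  obtain \<beta> where \<beta>: "bounded (range \<beta>)" and b: "b = conjugate_by U (pair_op \<beta> (\<lambda>_. 0))"
    using b_in by (auto simp: sa_unit_ball_def diag_algebra_def rotated_algebra_def)
  define \<kappa> where "\<kappa> = (\<lambda>j. cp j * cq j * (\<alpha> j - \<alpha> (partner j)) * (\<beta> j - \<beta> (partner j)))"
  have \<kappa>: "bounded (range \<kappa>)"
    unfolding \<kappa>_def by (intro bounded_range_intros \<alpha> \<beta> bounded_cp bounded_cq)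
  have \<kappa>_partner: "\<kappa> (partner j) = - \<kappa> j" for j
    by (simp add: \<kappa>_def algebra_simps)
  have \<kappa>_le: "cmod (\<kappa> j) \<le> 4 * \<bar>p j * q j\<bar>" for j
  proof -
    have "cmod (\<alpha> j) \<le> 1" "cmod (\<beta> j) \<le> 1" for j
      using order_trans[OF diag_coeff_le_onorm[OF \<alpha>, of j]] order_trans[OF rotated_coeff_le_onorm[OF \<beta>, of j]]
        a_in b_in by (auto simp: sa_unit_ball_def a b)
    then have "cmod (\<alpha> j - \<alpha> (partner j)) \<le> 2" "cmod (\<beta> j - \<beta> (partner j)) \<le> 2"
      by (smt (verit) norm_triangle_ineq4)+
    then have "cmod (\<alpha> j - \<alpha> (partner j)) * cmod (\<beta> j - \<beta> (partner j)) \<le> 2 * 2"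
      by (intro mult_mono) auto
    then have "\<bar>p j * q j\<bar> * (cmod (\<alpha> j - \<alpha> (partner j)) * cmod (\<beta> j - \<beta> (partner j))) \<le> \<bar>p j * q j\<bar> * 4"
      by (intro mult_left_mono) auto
    then show ?thesis
      by (simp add: \<kappa>_def norm_mult cp_def cq_def abs_mult mult_ac)
  qed
  have \<kappa>_sq_le: "cmod ((\<kappa> j)\<^sup>2) \<le> 16 * (p j * q j)\<^sup>2" for j
    using power_mono[OF \<kappa>_le[of j] norm_ge_zero, of 2] by (simp add: norm_power power_mult_distrib)
  have pq_le: "4 * (p j * q j)\<^sup>2 \<le> 1" for j
  proof -
    \<comment> \<open>The square of \<open>p^2 + q^2 = 1\<close> minus the square of
      \<open>p^2 - q^2\<close>.\<close>
    have "4 * (p j * q j)\<^sup>2 = 1 - ((p j)\<^sup>2 - (q j)\<^sup>2)\<^sup>2"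
      using pq_unit[of j] by algebra
    then show ?thesis by simp
  qed
  show "gamma_GE (diag_unbounded g) E (\<lambda>v. (- \<i>) *\<^sub>C commutator a b v) \<le> ereal (4 - r)"
  proof (rule gamma_GE_le[where c = "\<lambda>j. (\<kappa> j)\<^sup>2" and m = m, OF _ _ _ r g E])
    have h: "commutator a b = pair_op (\<lambda>_. 0) \<kappa>"
      by (simp add: a b commutator_diag_rotated \<alpha> \<beta> \<kappa>_def)
    show "(- \<i>) *\<^sub>C commutator a b ((- \<i>) *\<^sub>C commutator a b (ell2_unit j)) = (\<kappa> j)\<^sup>2 *\<^sub>C ell2_unit j" for j
    proof (rule ell2_eqI)
      have nth_h: "ell2_nth ((- \<i>) *\<^sub>C commutator a b v) n = - \<i> * \<kappa> n * ell2_nth v (partner n)" for v n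
        by (simp add: h ell2_nth_pair_op[OF bounded_range_const \<kappa>])
      have i_sq: "- \<i> * x * (- \<i> * (- x)) = x\<^sup>2" for x
        by (simp add: complex_eq_iff power2_eq_square algebra_simps)
      show "ell2_nth ((- \<i>) *\<^sub>C commutator a b ((- \<i>) *\<^sub>C commutator a b (ell2_unit j))) n =
          ell2_nth ((\<kappa> j)\<^sup>2 *\<^sub>C ell2_unit j) n" for n
        unfolding nth_h partner_partner \<kappa>_partner using i_sq[of "\<kappa> j"] by simp
    qed
    show "cmod ((\<kappa> j)\<^sup>2) \<le> 4" for j
      using \<kappa>_sq_le[of j] pq_le[of j] by linarith
    show "cmod ((\<kappa> j)\<^sup>2) \<le> 4 * (1 - r)" if "j < m" for j
      using order_trans[OF \<kappa>_sq_le[of j], of "4 * (1 - r)"] m[OF that] by simp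
  qed
qed

text \<open>The alternating sign operator plays three roles: it is \<open>a\<close>, its conjugate
  is \<open>b\<close>, and it is the test operator. It anticommutes with \<open>[a, b]\<close>,
  which doubles the norm \<open>4 * |p j * q j|\<close> found on a block.\<close>

lemma le_Gamma_MN_rotated: "ereal (8 * \<bar>p j * q j\<bar>) \<le> Gamma_MN diag_algebra rotated_algebra"
proof -
  define \<sigma> where "\<sigma> = (\<lambda>j :: nat. if even j then 1 else (- 1 :: complex))"
  have \<sigma>: "bounded (range \<sigma>)"
    by (auto simp: \<sigma>_def bounded_iff intro!: exI[of _ 1])
  have \<sigma>_partner: "\<sigma> (partner j) = - \<sigma> j" for j
    by (simp add: \<sigma>_def)
  have \<sigma>_sq: "\<sigma> j * \<sigma> j = 1" "cmod (\<sigma> j) = 1" for j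
    by (simp_all add: \<sigma>_def)
  define a where "a = pair_op \<sigma> (\<lambda>_. 0)"
  define b where "b = conjugate_by U a"
  have nth_a: "ell2_nth (a x) j = \<sigma> j * ell2_nth x j" for x j
    by (simp add: a_def ell2_nth_pair_op \<sigma> bounded_range_const)
  have norm_a: "norm (a x) \<le> norm x" for x
    using norm_ell2_le_bound[of "a x" 1 x] by (simp add: nth_a norm_mult \<sigma>_sq)
  have "bounded_op a"
    by (simp add: a_def bounded_op_pair_op \<sigma> bounded_range_const)
  have onorm_a: "onorm a \<le> 1"
    using norm_a by (intro onorm_bound) auto
  have adj_a: "is_adjoint a a"
  proof -
    have "(\<lambda>j. cnj (\<sigma> j)) = \<sigma>" by (auto simp: \<sigma>_def)
    then show ?thesis
      using is_adjoint_pair_op[OF \<sigma> bounded_range_const[of 0]] by (simp add: a_def)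
  qed
  have "a \<in> diag_algebra"
    using \<sigma> by (auto simp: a_def diag_algebra_def)
  then have a: "a \<in> sa_unit_ball diag_algebra"
    by (simp add: sa_unit_ball_def bounded_selfadjoint_def \<open>bounded_op a\<close> onorm_a adj_a)
  have "bounded_op b"
    using bounded_selfadjoint_U \<open>bounded_op a\<close> unfolding b_def conjugate_by_def bounded_selfadjoint_def
    by (intro bounded_op_compose) auto
  moreover have "is_adjoint b b"
    using bounded_selfadjoint_U adj_a by (simp add: is_adjoint_def b_def conjugate_by_def bounded_selfadjoint_def)
  moreover have "norm (b x) \<le> norm x" for x
    using norm_a[of "U x"] by (simp add: b_def conjugate_by_def)
  then have "onorm b \<le> 1"
    by (intro onorm_bound) auto
  moreover have "b \<in> rotated_algebra"
    using \<open>a \<in> diag_algebra\<close> by (simp add: b_def rotated_algebra_def)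
  ultimately have b: "b \<in> sa_unit_ball rotated_algebra"
    by (simp add: sa_unit_ball_def bounded_selfadjoint_def)
  \<comment> \<open>The 4 is the square of the sign difference, 2 or -2, within a block.\<close>
  define \<kappa> where "\<kappa> = (\<lambda>j. 4 * (cp j * cq j))"
  have \<kappa>: "bounded (range \<kappa>)"
    unfolding \<kappa>_def by (intro bounded_range_intros bounded_cp bounded_cq)
  have "(\<lambda>j. cp j * cq j * (\<sigma> j - \<sigma> (partner j)) * (\<sigma> j - \<sigma> (partner j))) = \<kappa>"
    by (auto simp: \<kappa>_def \<sigma>_partner \<sigma>_def)
  then have h: "commutator a b = pair_op (\<lambda>_. 0) \<kappa>"
    by (simp add: a_def b_def commutator_diag_rotated \<sigma>)
  have "derivation_commutator a b a (ell2_unit j) = (2 * \<sigma> j * \<kappa> j) *\<^sub>C ell2_unit (partner j)"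
  proof (rule ell2_eqI)
    fix n
    have n: "partner n = j \<longleftrightarrow> n = partner j" by auto
    show "ell2_nth (derivation_commutator a b a (ell2_unit j)) n =
        ell2_nth ((2 * \<sigma> j * \<kappa> j) *\<^sub>C ell2_unit (partner j)) n"
      by (simp add: derivation_commutator_eq \<open>bounded_op a\<close> \<open>bounded_op b\<close> h
          ell2_nth_pair_op[OF bounded_range_const \<kappa>] nth_a n)
        (simp add: \<kappa>_def \<sigma>_partner)
  qed
  moreover have "norm (c *\<^sub>C ell2_unit i) = cmod c" for c i
  proof -
    have "complex_of_real ((norm (c *\<^sub>C ell2_unit i))\<^sup>2) = complex_of_real ((cmod c)\<^sup>2)"
      by (simp only: cinner_self[symmetric] complex_norm_square)
        (simp add: cinner_scaleC_right mult.commute)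
    then show ?thesis
      by (simp only: of_real_eq_iff power2_eq_iff_nonneg norm_ge_zero)
  qed
  ultimately have "norm (derivation_commutator a b a (ell2_unit j)) = 8 * \<bar>p j * q j\<bar>"
    by (simp add: norm_mult \<sigma>_sq \<kappa>_def cp_def cq_def abs_mult)
  then have "ereal (8 * \<bar>p j * q j\<bar>) \<le> cb_norm (derivation_commutator a b)"
    using norm_derivation_commutator_le_cb_norm[OF \<open>bounded_op a\<close> onorm_a, of "ell2_unit j" a b] by simp
  also have "\<dots> \<le> Gamma_MN diag_algebra rotated_algebra"
    unfolding Gamma_MN_def by (rule SUP_upper2[of "(a, b)"]) (use a b in auto)
  finally show ?thesis .
qed

end


section \<open>The counterexample\<close>

text \<open>Growth at least linear gives square-summable resolvent entries and finite level sets;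
  the two prescribed values supply the kernel and the first positive eigenvalue.\<close>

lemma admissible_triple_diag_unbounded:
  assumes g: "\<And>j. 2 \<le> j \<Longrightarrow> real j \<le> g j" "g 0 = 0" "g 1 = 1"
    and "von_neumann_algebra M" "von_neumann_algebra N"
  shows "admissible_triple (diag_unbounded g) M N"
proof -
  have ge: "real j \<le> g j" for j
    using g by (cases "2 \<le> j") (auto simp: not_le less_2_cases_iff)
  have nonneg: "0 \<le> g j" for j
    using ge[of j] by linarith
  have "summable (\<lambda>j. 1 / (real (Suc j))\<^sup>2)"
    using inverse_power_summable[of 2, where 'a = real]
    by (subst summable_Suc_iff[of "\<lambda>j. 1 / (real j)\<^sup>2"]) (simp add: field_simps)
  then have "summable (\<lambda>j. (1 / (g j + 1))\<^sup>2)"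
  proof (rule summable_comparison_test[rotated], intro exI allI impI)
    fix j
    have "(1 / (g j + 1))\<^sup>2 \<le> (1 / real (Suc j))\<^sup>2"
      using ge[of j] by (intro power_mono divide_left_mono) auto
    then show "norm ((1 / (g j + 1))\<^sup>2) \<le> 1 / (real (Suc j))\<^sup>2"
      by (simp add: power_divide)
  qed
  then have "compact_resolvent (diag_unbounded g)"
    by (rule compact_resolvent_diag_unbounded[OF nonneg])
  moreover have "finite {j. g j = \<mu>}" for \<mu>
  proof (rule finite_subset)
    show "{j. g j = \<mu>} \<subseteq> {..nat \<lceil>\<mu>\<rceil>}"
      using ge by (auto simp: le_nat_iff) (metis ceiling_mono ceiling_of_nat of_nat_le_iff nat_mono nat_int)
  qed simp
  then have "finite_multiplicities (diag_unbounded g)"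
    by (rule finite_multiplicities_diag_unbounded)
  moreover have "\<mu> \<notin> range g" if "0 < \<mu>" "\<mu> < 1" for \<mu>
  proof
    assume "\<mu> \<in> range g"
    then obtain j where j: "\<mu> = g j" by auto
    have "j \<noteq> 0" "j \<noteq> 1"
      using that j g(2,3) by (metis less_irrefl)+
    then have "2 \<le> real j" by simp
    then show False
      using that(2) j ge[of j] by linarith
  qed
  moreover have "1 \<in> range g"
    using g(3) by (metis rangeI)
  ultimately show ?thesis
    using assms(4,5) INF_op_spectrum_diag_unbounded[of g 0, OF nonneg g(2)]
    by (simp add: admissible_triple_def positive_selfadjoint_diag_unbounded nonneg
        is_eigenvalue_diag_unbounded_iff)
qed

text \<open>The energies are an input, subject only to monotonicity and \<open>k < E k\<close>.
  Linear ones serve the existence claim, while refuting a universal rate needs energies adapted to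
  that rate.\<close>

lemma slow_convergence_example:
  fixes r E :: "nat \<Rightarrow> real"
  assumes r: "\<And>k. 1 \<le> k \<Longrightarrow> 0 < r k" "\<And>k. 1 \<le> k \<Longrightarrow> r k < 1"
    and anti: "\<And>k. 1 \<le> k \<Longrightarrow> r (Suc k) \<le> r k" and lim: "r \<longlonglongrightarrow> 0"
    and E: "mono E" "\<And>k. real k < E k"
  obtains G :: "ell2 unbounded_op" and M N where "admissible_triple G M N" "Gamma_MN M N = 4"
    "\<And>k. 1 \<le> k \<Longrightarrow> Gamma_GE G (E k) M N \<le> ereal (4 - r k)"
proof -
  \<comment> \<open>Here \<open>s j\<close> is the absolute cosine of the block angle, whose squared
    sine is to be 1 minus the rate; \<open>p\<close> and \<open>q\<close> then come from the
    half-angle formulas. The shift by \<open>Suc\<close> makes block 0 use \<open>r 1\<close>, as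
    nothing is assumed of \<open>r 0\<close>.\<close>
  define s where "s = (\<lambda>j. sqrt (r (Suc (j div 2))))"
  define p where "p = (\<lambda>j :: nat. (if even j then 1 else -1) * sqrt ((1 - s j) / 2))"
  define q where "q = (\<lambda>j :: nat. sqrt ((1 + s j) / 2))"
  \<comment> \<open>From index 2 on this is the threshold of \<open>gamma_GE_le\<close> at
    \<open>k = j\<close>. The thresholds grow with the index, so all later eigenvalues exceed that
    of \<open>k\<close> as well.\<close>
  define g where "g = (\<lambda>j :: nat. if j = 0 then 0 else if j = 1 then 1 else 2 * E j / r j)"
  have r_anti: "r k \<le> r j" if "1 \<le> j" "j \<le> k" for j k
    using that(2)
  proof (induction rule: dec_induct)
    case (step n)
    then show ?case using anti[of n] that(1) by linarith
  qed simp
  have s: "0 \<le> s j" "s j \<le> 1" for j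
    using r[of "Suc (j div 2)"] by (auto simp: s_def)
  have pq_sq: "(p j)\<^sup>2 = (1 - s j) / 2" "(q j)\<^sup>2 = (1 + s j) / 2" for j
    using s[of j] by (simp_all add: p_def q_def power_mult_distrib)
  interpret pair_rotation p q
  proof
    show "p (partner j) = - p j" "q (partner j) = q j" for j
      by (auto simp: p_def q_def s_def)
    show "(p j)\<^sup>2 + (q j)\<^sup>2 = 1" for j
      using pq_sq[of j] by simp
  qed
  have pq: "4 * (p j * q j)\<^sup>2 = 1 - r (Suc (j div 2))" for j
  proof -
    have "4 * (p j * q j)\<^sup>2 = 4 * ((1 - s j) / 2 * ((1 + s j) / 2))"
      by (simp only: power_mult_distrib pq_sq)
    also have "\<dots> = 1 - (s j)\<^sup>2"
      by (simp add: power2_eq_square field_simps)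
    finally have "4 * (p j * q j)\<^sup>2 = 1 - (s j)\<^sup>2" .
    then show ?thesis
      using r(1)[of "Suc (j div 2)"] by (simp add: s_def)
  qed
  have g_ge: "2 * E k / r k \<le> g j" if "1 \<le> k" "2 * k \<le> j" for j k
  proof -
    have "k \<le> j" "1 \<le> j" "2 \<le> j" using that by auto
    then have "E k \<le> E j" "r j \<le> r k" "0 < r j" "0 < E j"
      using E(1) E(2)[of j] r_anti[OF that(1)] r(1)[of j] by (auto simp: mono_def)
    then have "2 * E k / r k \<le> 2 * E j / r j"
      by (intro frac_le) auto
    with \<open>2 \<le> j\<close> show ?thesis by (simp add: g_def)
  qed
  have g_ge_id: "real j \<le> g j" if "2 \<le> j" for j
  proof -
    have "real j \<le> 2 * E j / 1"
      using E(2)[of j] by linarith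
    also have "\<dots> \<le> 2 * E j / r j"
      using r[of j] E(2)[of j] that by (intro divide_left_mono) auto
    finally show ?thesis using that by (simp add: g_def)
  qed
  have g_nonneg: "0 \<le> g j" for j
  proof (cases "2 \<le> j")
    case True
    then show ?thesis using g_ge_id[of j] by linarith
  qed (auto simp: g_def)
  show thesis
  proof (rule that[of "diag_unbounded g" diag_algebra rotated_algebra])
    show "admissible_triple (diag_unbounded g) diag_algebra rotated_algebra"
      by (rule admissible_triple_diag_unbounded[OF g_ge_id _ _ von_neumann_diag_algebra
            von_neumann_rotated_algebra]) (simp_all add: g_def)
    \<comment> \<open>Block \<open>n\<close> yields the lower bound
      \<open>4 * sqrt (1 - r (Suc n))\<close>; the value 4 comes from the limit over the
      blocks.\<close>
    have Gamma_lim: "(\<lambda>n. ereal (4 * sqrt (1 - r (Suc n)))) \<longlonglongrightarrow> ereal (4 * sqrt (1 - 0))"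
      by (intro tendsto_intros LIMSEQ_Suc lim)
    have Gamma_ge: "ereal (4 * sqrt (1 - r (Suc n))) \<le> Gamma_MN diag_algebra rotated_algebra" for n
    proof -
      have "1 - r (Suc n) = (2 * \<bar>p (2 * n) * q (2 * n)\<bar>)\<^sup>2"
        using pq[of "2 * n"] by (simp add: power_mult_distrib)
      then have "sqrt (1 - r (Suc n)) = 2 * \<bar>p (2 * n) * q (2 * n)\<bar>"
        by (simp only: real_sqrt_abs)
      then show ?thesis
        using le_Gamma_MN_rotated[of "2 * n"] by simp
    qed
    have Gamma_ge_4: "ereal (4 * sqrt (1 - 0)) \<le> Gamma_MN diag_algebra rotated_algebra"
      by (rule LIMSEQ_le_const2[OF Gamma_lim]) (use Gamma_ge in blast)
    show "Gamma_MN diag_algebra rotated_algebra = 4"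
      by (rule antisym[OF Gamma_MN_le]) (use Gamma_ge_4 in simp)
    show "Gamma_GE (diag_unbounded g) (E k) diag_algebra rotated_algebra \<le> ereal (4 - r k)"
      if "1 \<le> k" for k
    proof (rule Gamma_GE_rotated_le[where m = "2 * k"])
      \<comment> \<open>The first \<open>k\<close> blocks have \<open>Suc (j div 2) \<le> k\<close>,
        where the decreasing rate is still at least \<open>r k\<close>.\<close>
      show "4 * (p j * q j)\<^sup>2 \<le> 1 - r k" if "j < 2 * k" for j
        unfolding pq using r_anti[of "Suc (j div 2)" k] that by auto
      show "0 < E k"
        using E(2)[of k] by linarith
    qed (use r that g_nonneg g_ge in auto)
  qed
qed

theorem proposition4p16:
  shows
    "(\<forall>r :: nat \<Rightarrow> real.
        (\<forall>k\<ge>1. 0 < r k \<and> r k < 1) \<and> (\<forall>k\<ge>1. r (Suc k) \<le> r k) \<and> r \<longlonglongrightarrow> 0 \<longrightarrow>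
        (\<exists>(G :: ell2 unbounded_op) M N (E :: nat \<Rightarrow> real).
           admissible_triple G M N \<and>
           (\<forall>k\<ge>1. 0 < E k) \<and> filterlim E at_top sequentially \<and>
           Gamma_MN M N = 4 \<and>
           (\<forall>k\<ge>3. ereal (r k) \<le> 4 - Gamma_GE G (E k) M N)))
     \<and>
     \<not> (\<exists>R :: real \<Rightarrow> real.
          (\<forall>E\<ge>0. 0 \<le> R E) \<and> (R \<longlongrightarrow> 0) at_top \<and>
          (\<forall>(G :: ell2 unbounded_op) M N. admissible_triple G M N \<longrightarrow>
             (\<forall>\<^sub>F E in at_top. Gamma_MN M N - Gamma_GE G E M N \<le> ereal (R E))))"
proof (intro conjI allI impI notI)
  have gap: "ereal c \<le> 4 - x" if "x \<le> ereal (4 - c)" for x c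
    using that by (cases x) auto
  {
    fix r :: "nat \<Rightarrow> real"
    assume r: "(\<forall>k\<ge>1. 0 < r k \<and> r k < 1) \<and> (\<forall>k\<ge>1. r (Suc k) \<le> r k) \<and> r \<longlonglongrightarrow> 0"
    define E where "E = (\<lambda>k. real (Suc k))"
    obtain G :: "ell2 unbounded_op" and M N where GMN: "admissible_triple G M N" "Gamma_MN M N = 4"
      "\<And>k. 1 \<le> k \<Longrightarrow> Gamma_GE G (E k) M N \<le> ereal (4 - r k)"
      by (rule slow_convergence_example[of r E]) (use r in \<open>auto simp: E_def mono_def\<close>)
    moreover have "\<forall>k\<ge>3. ereal (r k) \<le> 4 - Gamma_GE G (E k) M N"
      by (intro allI impI gap GMN(3)) auto
    moreover have "\<forall>k\<ge>1. 0 < E k"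
      by (simp add: E_def)
    moreover have "filterlim E at_top sequentially"
      unfolding E_def by (rule filterlim_compose[OF filterlim_real_sequentially filterlim_Suc])
    ultimately show "\<exists>(G :: ell2 unbounded_op) M N (E :: nat \<Rightarrow> real).
           admissible_triple G M N \<and>
           (\<forall>k\<ge>1. 0 < E k) \<and> filterlim E at_top sequentially \<and>
           Gamma_MN M N = 4 \<and>
           (\<forall>k\<ge>3. ereal (r k) \<le> 4 - Gamma_GE G (E k) M N)"
      by blast
  next
    assume "\<exists>R :: real \<Rightarrow> real.
          (\<forall>E\<ge>0. 0 \<le> R E) \<and> (R \<longlongrightarrow> 0) at_top \<and>
          (\<forall>(G :: ell2 unbounded_op) M N. admissible_triple G M N \<longrightarrow>
             (\<forall>\<^sub>F E in at_top. Gamma_MN M N - Gamma_GE G E M N \<le> ereal (R E)))"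
    then obtain R :: "real \<Rightarrow> real" where lim: "(R \<longlongrightarrow> 0) at_top"
      and R: "\<And>(G :: ell2 unbounded_op) M N. admissible_triple G M N \<Longrightarrow>
             \<forall>\<^sub>F E in at_top. Gamma_MN M N - Gamma_GE G E M N \<le> ereal (R E)"
      by blast
    \<comment> \<open>A concrete positive rate tending to 0, against which the supposed
      \<open>R\<close> is compared.\<close>
    define r where "r = (\<lambda>k. 1 / real (Suc (Suc k)))"
    have "\<exists>e. \<forall>x\<ge>e. R x < r k" for k
      using order_tendstoD(2)[OF lim, of "r k"] by (simp add: r_def eventually_at_top_linorder)
    then obtain e where e: "\<And>k x. e k \<le> x \<Longrightarrow> R x < r k"
      by metis
    \<comment> \<open>Summing the absolute thresholds makes \<open>E\<close> increasing and at least
      \<open>e k\<close> at index \<open>k\<close>, whence \<open>R (E k) < r k\<close>; the term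
      \<open>Suc k\<close> ensures \<open>k < E k\<close>.\<close>
    define E where "E = (\<lambda>k. real (Suc k) + (\<Sum>i\<le>k. \<bar>e i\<bar>))"
    have "mono E"
      unfolding E_def by (intro monoI add_mono sum_mono2) auto
    have E_gt: "real k < E k" for k
      by (simp add: E_def add_pos_nonneg sum_nonneg)
    have "r \<longlonglongrightarrow> 0"
      unfolding r_def using LIMSEQ_Suc[OF LIMSEQ_Suc[OF lim_1_over_n]] by simp
    obtain G :: "ell2 unbounded_op" and M N where GMN: "admissible_triple G M N" "Gamma_MN M N = 4"
      "\<And>k. 1 \<le> k \<Longrightarrow> Gamma_GE G (E k) M N \<le> ereal (4 - r k)"
      by (rule slow_convergence_example[of r E])
        (use \<open>mono E\<close> E_gt \<open>r \<longlonglongrightarrow> 0\<close> in \<open>auto simp: r_def frac_le\<close>)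
    obtain x where x: "\<And>y. x \<le> y \<Longrightarrow> 4 - Gamma_GE G y M N \<le> ereal (R y)"
      using R[OF GMN(1)] by (auto simp: GMN(2) eventually_at_top_linorder)
    \<comment> \<open>With \<open>x < k < E k\<close>, the supposed bound by \<open>R\<close> is in
      force at the energy \<open>E k\<close>.\<close>
    obtain k :: nat where k: "x < real k" "1 \<le> k"
      using reals_Archimedean2[of "max x 1"] by auto
    have "ereal (r k) \<le> 4 - Gamma_GE G (E k) M N"
      by (intro gap GMN(3) k)
    also have "\<dots> \<le> ereal (R (E k))"
      using x[of "E k"] E_gt[of k] k by simp
    finally have "r k \<le> R (E k)" by simp
    moreover have "e k \<le> E k"
      using member_le_sum[of k "{..k}" "\<lambda>i. \<bar>e i\<bar>"] by (simp add: E_def)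
    ultimately show False
      using e[of k "E k"] by simp
  }
qed

end
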